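(* Let $A$ be an infinite dimensional simple unital C*-algebra, and let $B\subset A$ be a centrally large subalgebra. If $RR(B)=0$, then $RR(A)=0$.
   Context: Real rank zero: a unital C*-algebra $A$ has real rank zero, written $RR(A)=0$, if the set of invertible self-adjoint elements of $A$ is dense in the set $A_{sa}$ of self-adjoint elements. Notation: $A_+$ is the set of positive elements of $A$. For a C*-algebra $C$ and $a,b\in (K\otimes C)_+$ ($K$ the compact operators on a separable infinite dimensional Hilbert space; $C$ is viewed inside $K\otimes C$ as the upper left corner), $a$ is Cuntz subequivalent to $b$ over $C$, written $a\precsim_C b$, if there is a sequence $(v_n)$ in $K\otimes C$ with $v_n b v_n^*\to a$ in norm. Large subalgebra: let $A$ be an infinite dimensional simple unital C*-algebra. A unital C*-subalgebra $B\subset A$ (containing the unit of $A$) is large in $A$ if for every positive integer $m$, all $a_1,\dots,a_m\in A$, every $\varepsilon>0$, every $x\in A_+$ with $\|x\|=1$, and every $y\in B_+\setminus\{0\}$, there are $c_1,\dots,c_m\in A$ and $g\in B$ such that: (1) $0\le g\le 1$; (2) $\|c_j-a_j\|<\varepsilon$ for $j=1,\dots,m$; (3) $(1-g)c_j\in B$ for $j=1,\dots,m$; (4) $g\precsim_B y$ and $g\precsim_A x$; (5) $\|(1-g)x(1-g)\|>1-\varepsilon$. $B$ is centrally large in $A$ if one can moreover always arrange, in addition to (1)-(5): (6) $\|ga_j-a_jg\|<\varepsilon$ for $j=1,\dots,m$. *)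

theory Defs
  imports "HOL-Analysis.Analysis"
begin

text \<open>Nonzero unital C*-algebras. In \<^class>\<open>real_normed_algebra_1\<close> the norm is submultiplicative
  and \<open>norm 1 = 1\<close>.\<close>

class cstar_algebra_1 = real_normed_algebra_1 + banach +
  fixes scaleC :: "complex \<Rightarrow> 'a \<Rightarrow> 'a" (infixr \<open>*\<^sub>C\<close> 75)
    and star :: "'a \<Rightarrow> 'a"
  assumes scaleC_add_right: "c *\<^sub>C (x + y) = c *\<^sub>C x + c *\<^sub>C y"
    and scaleC_add_left: "(c + d) *\<^sub>C x = c *\<^sub>C x + d *\<^sub>C x"
    and scaleC_scaleC: "c *\<^sub>C d *\<^sub>C x = (c * d) *\<^sub>C x"
    and scaleC_one: "1 *\<^sub>C x = x"
    and scaleR_scaleC: "r *\<^sub>R x = complex_of_real r *\<^sub>C x"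
    and mult_scaleC_left: "(c *\<^sub>C x) * y = c *\<^sub>C (x * y)"
    and mult_scaleC_right: "x * (c *\<^sub>C y) = c *\<^sub>C (x * y)"
    and norm_scaleC: "norm (c *\<^sub>C x) = cmod c * norm x"
    and star_star: "star (star x) = x"
    and star_add: "star (x + y) = star x + star y"
    and star_scaleC: "star (c *\<^sub>C x) = cnj c *\<^sub>C star x"
    and star_mult: "star (x * y) = star y * star x"
    and cstar_identity: "norm (star x * x) = (norm x)\<^sup>2"

definition cstar_subalgebra :: "'a::cstar_algebra_1 set \<Rightarrow> bool" where
  "cstar_subalgebra C \<longleftrightarrow> 1 \<in> C \<and> closed C \<and>
     (\<forall>x\<in>C. \<forall>y\<in>C. x + y \<in> C \<and> x * y \<in> C) \<and>
     (\<forall>c. \<forall>x\<in>C. c *\<^sub>C x \<in> C) \<and> (\<forall>x\<in>C. star x \<in> C)"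

text \<open>In what follows \<open>C\<close> stands for a unital C*-subalgebra, possibly \<open>UNIV\<close>, and all notions are
  those of the C*-algebra \<open>C\<close> itself.\<close>

definition closed_ideal_of :: "'a::cstar_algebra_1 set \<Rightarrow> 'a set \<Rightarrow> bool" where
  "closed_ideal_of C I \<longleftrightarrow> I \<subseteq> C \<and> closed I \<and> 0 \<in> I \<and>
     (\<forall>x\<in>I. \<forall>y\<in>I. x + y \<in> I) \<and> (\<forall>c. \<forall>x\<in>I. c *\<^sub>C x \<in> I) \<and>
     (\<forall>a\<in>C. \<forall>x\<in>I. a * x \<in> I \<and> x * a \<in> I)"

definition simple_cstar :: "'a::cstar_algebra_1 set \<Rightarrow> bool" where
  "simple_cstar C \<longleftrightarrow> (\<forall>I. closed_ideal_of C I \<longrightarrow> I = {0} \<or> I = C)"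

definition infinite_dimensional :: "'a::cstar_algebra_1 set \<Rightarrow> bool" where
  "infinite_dimensional C \<longleftrightarrow> \<not> (\<exists>S. finite S \<and> S \<subseteq> C \<and> C \<subseteq> module.span scaleC S)"

definition invertible_in :: "'a::cstar_algebra_1 set \<Rightarrow> 'a \<Rightarrow> bool" where
  "invertible_in C a \<longleftrightarrow> a \<in> C \<and> (\<exists>b\<in>C. a * b = 1 \<and> b * a = 1)"

definition self_adjoint_of :: "'a::cstar_algebra_1 set \<Rightarrow> 'a set" where
  "self_adjoint_of C = {a\<in>C. star a = a}"

definition real_rank_zero :: "'a::cstar_algebra_1 set \<Rightarrow> bool" where
  "real_rank_zero C \<longleftrightarrow>
     self_adjoint_of C \<subseteq> closure {b \<in> self_adjoint_of C. invertible_in C b}"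

definition spectrum_in :: "'a::cstar_algebra_1 set \<Rightarrow> 'a \<Rightarrow> complex set" where
  "spectrum_in C a = {c. \<not> invertible_in C (c *\<^sub>C 1 - a)}"

definition positive_of :: "'a::cstar_algebra_1 set \<Rightarrow> 'a set" where
  "positive_of C = {a \<in> self_adjoint_of C. spectrum_in C a \<subseteq> complex_of_real ` {0..}}"

text \<open>The stabilization \<open>K \<otimes> C\<close> is realized as the completion of the finite matrices over \<open>C\<close>:
  it consists of the infinite matrices \<open>T\<close> over \<open>C\<close> that are limits of finitely supported ones.
  The norm on finite matrices is the unique C*-norm, obtained as the operator norm on the
  Hilbert \<open>C\<close>-module \<open>C\<^sup>n\<close> with inner product \<open>\<langle>x, y\<rangle> = \<Sum>i. x\<^sub>i\<^sup>* y\<^sub>i\<close>, that is,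
  the supremum of \<open>\<parallel>\<langle>x, T y\<rangle>\<parallel>\<close> over \<open>x\<close>, \<open>y\<close> in the unit ball. For an infinite matrix the
  supremum is over all \<open>n\<close> and may be infinite, hence the type \<^typ>\<open>ennreal\<close>.\<close>

definition module_ball :: "'a::cstar_algebra_1 set \<Rightarrow> nat \<Rightarrow> (nat \<Rightarrow> 'a) set" where
  "module_ball C n = {x. (\<forall>i<n. x i \<in> C) \<and> norm (\<Sum>i<n. star (x i) * x i) \<le> 1}"

definition mat_norm :: "'a::cstar_algebra_1 set \<Rightarrow> (nat \<Rightarrow> nat \<Rightarrow> 'a) \<Rightarrow> ennreal" where
  "mat_norm C T = (SUP n. SUP x \<in> module_ball C n. SUP y \<in> module_ball C n.
     ennreal (norm (\<Sum>i<n. \<Sum>j<n. star (x i) * T i j * y j)))"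

definition fin_mats :: "'a::cstar_algebra_1 set \<Rightarrow> (nat \<Rightarrow> nat \<Rightarrow> 'a) set" where
  "fin_mats C = {F. (\<forall>i j. F i j \<in> C) \<and> (\<exists>n. \<forall>i j. n \<le> i \<or> n \<le> j \<longrightarrow> F i j = 0)}"

definition stabilization :: "'a::cstar_algebra_1 set \<Rightarrow> (nat \<Rightarrow> nat \<Rightarrow> 'a) set" where
  "stabilization C = {T. (\<forall>i j. T i j \<in> C) \<and>
     (\<forall>\<epsilon>>0. \<exists>F \<in> fin_mats C. mat_norm C (\<lambda>i j. T i j - F i j) < \<epsilon>)}"

text \<open>The series in the product converges unconditionally in norm for matrices in
  \<open>stabilization C\<close>.\<close>

definition mat_mult ::
  "(nat \<Rightarrow> nat \<Rightarrow> 'a::cstar_algebra_1) \<Rightarrow> (nat \<Rightarrow> nat \<Rightarrow> 'a) \<Rightarrow> nat \<Rightarrow> nat \<Rightarrow> 'a" where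
  "mat_mult S T = (\<lambda>i j. \<Sum>\<^sub>\<infinity>k. S i k * T k j)"

definition mat_star ::
  "(nat \<Rightarrow> nat \<Rightarrow> 'a::cstar_algebra_1) \<Rightarrow> nat \<Rightarrow> nat \<Rightarrow> 'a" where
  "mat_star T = (\<lambda>i j. star (T j i))"

definition corner :: "'a::cstar_algebra_1 \<Rightarrow> nat \<Rightarrow> nat \<Rightarrow> 'a" where
  "corner a = (\<lambda>i j. if i = 0 \<and> j = 0 then a else 0)"

text \<open>Cuntz subequivalence in \<open>K \<otimes> C\<close>; it is meant for positive \<open>a\<close> and \<open>b\<close>.\<close>

definition cuntz_le ::
  "'a::cstar_algebra_1 set \<Rightarrow> (nat \<Rightarrow> nat \<Rightarrow> 'a) \<Rightarrow> (nat \<Rightarrow> nat \<Rightarrow> 'a) \<Rightarrow> bool" where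
  "cuntz_le C a b \<longleftrightarrow> (\<exists>v :: nat \<Rightarrow> nat \<Rightarrow> nat \<Rightarrow> 'a. (\<forall>n. v n \<in> stabilization C) \<and>
     (\<lambda>n. mat_norm C (\<lambda>i j. mat_mult (mat_mult (v n) b) (mat_star (v n)) i j - a i j))
       \<longlonglongrightarrow> 0)"

definition large_witness :: "'a::cstar_algebra_1 set \<Rightarrow> nat \<Rightarrow> (nat \<Rightarrow> 'a) \<Rightarrow> real \<Rightarrow> 'a \<Rightarrow> 'a \<Rightarrow>
    (nat \<Rightarrow> 'a) \<Rightarrow> 'a \<Rightarrow> bool" where
  "large_witness B m a \<epsilon> x y c g \<longleftrightarrow>
     g \<in> positive_of B \<and> 1 - g \<in> positive_of B \<and>
     (\<forall>j\<in>{1..m}. norm (c j - a j) < \<epsilon>) \<and>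
     (\<forall>j\<in>{1..m}. (1 - g) * c j \<in> B) \<and>
     cuntz_le B (corner g) (corner y) \<and> cuntz_le UNIV (corner g) (corner x) \<and>
     norm ((1 - g) * x * (1 - g)) > 1 - \<epsilon>"

text \<open>The ambient algebra \<open>A\<close> is the whole type.\<close>

definition large :: "'a::cstar_algebra_1 set \<Rightarrow> bool" where
  "large B \<longleftrightarrow> cstar_subalgebra B \<and>
     (\<forall>m\<ge>1. \<forall>a. \<forall>\<epsilon>>0. \<forall>x\<in>positive_of UNIV. \<forall>y\<in>positive_of B - {0}. norm x = 1 \<longrightarrow>
       (\<exists>c g. large_witness B m a \<epsilon> x y c g))"

definition centrally_large :: "'a::cstar_algebra_1 set \<Rightarrow> bool" where
  "centrally_large B \<longleftrightarrow> cstar_subalgebra B \<and>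
     (\<forall>m\<ge>1. \<forall>a. \<forall>\<epsilon>>0. \<forall>x\<in>positive_of UNIV. \<forall>y\<in>positive_of B - {0}. norm x = 1 \<longrightarrow>
       (\<exists>c g. large_witness B m a \<epsilon> x y c g \<and>
         (\<forall>j\<in>{1..m}. norm (g * a j - a j * g) < \<epsilon>)))"

end

theory Submission
  imports Defs
begin

text \<open>Let \<open>a\<close> be self-adjoint and not invertible, and let \<open>x\<close> be a positive element of norm \<open>1\<close> with
  \<open>x a\<close> small. Central largeness gives \<open>g\<close> almost commuting with \<open>a\<close> such that \<open>(1 - g) x (1 - g)\<close> is
  almost in \<open>B\<close>, has norm near \<open>1\<close> and almost annihilates \<open>a\<close>. As \<open>B\<close> has real rank zero, there
  is a nonzero projection \<open>r\<close> in \<open>B\<close> with \<open>r a\<close> small, and cutting down by \<open>1 - r\<close> one may assume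
  \<open>r a = 0\<close>.

  A second application of largeness gives \<open>g \<precsim>\<^sub>B r\<close> with \<open>(1 - g) a\<close> almost in \<open>B\<close>. Real rank zero
  yields a projection \<open>p \<le> 1 - r\<close> in \<open>B\<close> that carries \<open>(1 - r) g (1 - r)\<close> up to a small error and is
  equivalent in \<open>B\<close> to a projection \<open>q \<le> r\<close>. Outside of \<open>p\<close> and \<open>q\<close> the corner of \<open>a\<close> is almost in
  \<open>B\<close>, so it is close to an invertible element \<open>D\<close>. In the decomposition \<open>1 = p + q + s\<close>, the
  element with rows \<open>(\<alpha>, u, \<beta>)\<close>, \<open>(u\<^sup>*, 0, 0)\<close>, \<open>(\<beta>\<^sup>*, 0, D)\<close> is then close to \<open>a\<close> for \<open>u\<close> a small
  multiple of an equivalence between \<open>p\<close> and \<open>q\<close>. It is invertible whatever \<open>\<alpha>\<close> and \<open>\<beta>\<close> are.\<close>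

section \<open>The involution, Neumann series and square roots\<close>

lemma star_scaleR: "star (r *\<^sub>R x) = r *\<^sub>R star (x :: 'a::cstar_algebra_1)"
  by (simp add: scaleR_scaleC star_scaleC)

lemma scaleC_minus_left: "(- c) *\<^sub>C x = - (c *\<^sub>C (x :: 'a::cstar_algebra_1))"
proof -
  have "(- c) *\<^sub>C x + c *\<^sub>C x = 0"
    using scaleR_scaleC[of 0 x] by (simp flip: scaleC_add_left)
  then show ?thesis
    by (simp add: eq_neg_iff_add_eq_0)
qed

lemma scaleC_diff_right: "c *\<^sub>C (x - y) = c *\<^sub>C x - c *\<^sub>C (y :: 'a::cstar_algebra_1)"
  using scaleC_add_right[of c "x - y" y] by simp

lemma norm_star [simp]: "norm (star x) = norm (x :: 'a::cstar_algebra_1)"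
proof -
  have le: "norm y \<le> norm (star y)" for y :: 'a
  proof (cases "norm y = 0")
    case False
    have "norm y * norm y \<le> norm (star y) * norm y"
      using cstar_identity[of y] norm_mult_ineq[of "star y" y] by (simp add: power2_eq_square)
    then show ?thesis
      using False by simp
  qed simp
  show ?thesis
    using le[of x] le[of "star x"] by (simp add: star_star)
qed

lemma bounded_linear_star: "bounded_linear (star :: 'a::cstar_algebra_1 \<Rightarrow> 'a)"
  by (rule bounded_linear_intro[where K = 1]) (auto simp: star_add star_scaleR)

lemmas star_diff = linear_diff[OF bounded_linear.linear[OF bounded_linear_star]]
  and star_minus = linear_neg[OF bounded_linear.linear[OF bounded_linear_star]]
  and star_0 [simp] = linear_0[OF bounded_linear.linear[OF bounded_linear_star]]
  and continuous_on_star [continuous_intros] = bounded_linear.continuous_on[OF bounded_linear_star]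

lemma star_1 [simp]: "star 1 = (1 :: 'a::cstar_algebra_1)"
  by (metis mult.left_neutral mult.right_neutral star_mult star_star)

lemmas star_simps = star_add star_diff star_minus star_mult star_scaleR star_star

lemma norm_mult_star: "norm (x * star x) = (norm (x :: 'a::cstar_algebra_1))\<^sup>2"
  using cstar_identity[of "star x"] by (simp add: star_star)

lemma norm_square_self_adjoint: "star h = h \<Longrightarrow> norm (h * h) = (norm (h :: 'a::cstar_algebra_1))\<^sup>2"
  using cstar_identity[of h] by simp

lemma commute_inverse:
  fixes x :: "'a::monoid_mult"
  assumes "x * y = 1" "y * x = 1" "w * x = x * w"
  shows "w * y = y * w"
proof -
  have "w * y = y * x * w * y"
    by (simp add: assms)
  also have "\<dots> = y * (x * w) * y"
    by (simp add: mult.assoc)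
  also have "\<dots> = y * w"
    by (simp add: assms(3)[symmetric] mult.assoc assms(1))
  finally show ?thesis .
qed

lemma cstar_subalgebra_UNIV: "cstar_subalgebra UNIV"
  by (simp add: cstar_subalgebra_def)

context
  fixes C :: "'a::cstar_algebra_1 set"
  assumes C: "cstar_subalgebra C"
begin

lemma subalgebra_one: "1 \<in> C"
  and subalgebra_closed: "closed C"
  and subalgebra_add: "x \<in> C \<Longrightarrow> y \<in> C \<Longrightarrow> x + y \<in> C"
  and subalgebra_mult: "x \<in> C \<Longrightarrow> y \<in> C \<Longrightarrow> x * y \<in> C"
  and subalgebra_scaleC: "x \<in> C \<Longrightarrow> c *\<^sub>C x \<in> C"
  and subalgebra_star: "x \<in> C \<Longrightarrow> star x \<in> C"
  using C by (auto simp: cstar_subalgebra_def)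

lemma subalgebra_scaleR: "x \<in> C \<Longrightarrow> r *\<^sub>R x \<in> C"
  by (simp add: scaleR_scaleC subalgebra_scaleC)

lemma subalgebra_minus: "x \<in> C \<Longrightarrow> - x \<in> C"
  using subalgebra_scaleR[of x "-1"] by simp

lemma subalgebra_diff: "x \<in> C \<Longrightarrow> y \<in> C \<Longrightarrow> x - y \<in> C"
  using subalgebra_add[of x "- y"] by (simp add: subalgebra_minus)

lemma subalgebra_zero: "0 \<in> C"
  using subalgebra_diff[OF subalgebra_one subalgebra_one] by simp

lemmas subalgebra = subalgebra_one subalgebra_zero subalgebra_add subalgebra_mult subalgebra_scaleC
  subalgebra_star subalgebra_scaleR subalgebra_minus subalgebra_diff

text \<open>The inverse is the fixed point of the contraction \<open>z \<mapsto> 1 + y * z\<close>.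
  Searching only among the elements of \<open>C\<close> that commute with \<open>y\<close> makes it
  two-sided.\<close>

lemma neumann_inverse:
  assumes "y \<in> C" "norm y < 1"
  obtains z where "z \<in> C" "(1 - y) * z = 1" "z * (1 - y) = 1" "norm z \<le> 1 / (1 - norm y)"
proof -
  define S where "S = {z \<in> C. z * y = y * z}"
  have "S = C \<inter> {z. z * y = y * z}"
    by (auto simp: S_def)
  moreover have "closed {z. z * y = y * z}"
    by (intro closed_Collect_eq continuous_intros)
  ultimately have "complete S"
    using subalgebra_closed by (simp add: complete_eq_closed closed_Int)
  moreover have "0 \<in> S"
    by (simp add: S_def subalgebra)
  moreover have "(\<lambda>z. 1 + y * z) ` S \<subseteq> S"
    using assms(1) by (auto simp: S_def subalgebra algebra_simps)
  moreover have "dist (1 + y * z) (1 + y * w) \<le> norm y * dist z w" for z w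
    using norm_mult_ineq[of y "z - w"] by (simp add: dist_norm algebra_simps)
  ultimately have "\<exists>!z\<in>S. 1 + y * z = z"
    by (intro Banach_fix[where c = "norm y"]) (use assms(2) in auto)
  then obtain z where z: "z \<in> C" "z * y = y * z" "1 + y * z = z"
    by (auto simp: S_def)
  have "norm z \<le> 1 + norm y * norm z"
    using norm_triangle_ineq[of 1 "y * z"] norm_mult_ineq[of y z] z(3) by simp
  then have "norm z \<le> 1 / (1 - norm y)"
    using assms(2) by (simp add: field_simps)
  moreover have "(1 - y) * z = 1" "z * (1 - y) = 1"
    using z(2,3) by (simp_all add: algebra_simps)
  ultimately show thesis
    using that z(1) by blast
qed

text \<open>The fixed point \<open>x\<close> of \<open>x \<mapsto> (y + x\<^sup>2) / 2\<close> satisfies \<open>(1 - x)\<^sup>2 = 1 - y\<close>.\<close>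

lemma square_root_near_one:
  assumes "y \<in> C" "star y = y" "norm y < 1"
  obtains h where "h \<in> C" "star h = h" "h * h = 1 - y" "norm (1 - h) < 1"
    "\<And>w. w * y = y * w \<Longrightarrow> w * h = h * w"
proof -
  \<comment> \<open>The smaller root of \<open>\<rho>\<^sup>2 - 2 * \<rho> + norm y = 0\<close>: the
    map then sends the ball of radius \<rho> into itself, with contraction constant \<rho> <
    1.\<close>
  define \<rho> where "\<rho> = 1 - sqrt (1 - norm y)"
  have \<rho>: "0 \<le> \<rho>" "\<rho> < 1"
    using assms(3) by (auto simp: \<rho>_def)
  have \<rho>2: "\<rho>\<^sup>2 = 2 * \<rho> - norm y"
    using assms(3) by (simp add: \<rho>_def power2_diff)
  \<comment> \<open>Everything wanted of the fixed point is a closed condition preserved by the map,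
    so it is built into the domain.\<close>
  define S where "S = {x. norm x \<le> \<rho>} \<inter> C \<inter> {x. star x = x} \<inter> (\<Inter>w\<in>{w. w * y = y * w}. {x. w * x = x * w})"
  have S_I: "x \<in> S" if "norm x \<le> \<rho>" "x \<in> C" "star x = x" "\<And>w. w * y = y * w \<Longrightarrow> w * x = x * w" for x
    using that unfolding S_def by blast
  have S_D: "norm x \<le> \<rho>" "x \<in> C" "star x = x" "w * y = y * w \<Longrightarrow> w * x = x * w" if "x \<in> S" for x w
    using that unfolding S_def by blast+
  have "closed S"
    unfolding S_def
    by (intro closed_Int closed_INT ballI closed_Collect_eq closed_Collect_le continuous_intros
        subalgebra_closed)
  then have "complete S"
    by (simp add: complete_eq_closed)
  moreover have "0 \<in> S"
    using \<rho> by (intro S_I) (simp_all add: subalgebra)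
  moreover have "(1/2) *\<^sub>R (y + x * x) \<in> S" if x: "x \<in> S" for x
  proof (rule S_I)
    have "norm (x * x) \<le> \<rho>\<^sup>2"
      using S_D(1,3)[OF x] power_mono[of "norm x" \<rho> 2] by (simp add: norm_square_self_adjoint)
    then show "norm ((1/2) *\<^sub>R (y + x * x)) \<le> \<rho>"
      using norm_triangle_ineq[of y "x * x"] \<rho>2 by simp
    show "(1/2) *\<^sub>R (y + x * x) \<in> C" "star ((1/2) *\<^sub>R (y + x * x)) = (1/2) *\<^sub>R (y + x * x)"
      using S_D(2,3)[OF x] assms(1,2) by (simp_all add: subalgebra star_simps)
    show "w * (1/2) *\<^sub>R (y + x * x) = (1/2) *\<^sub>R (y + x * x) * w" if w: "w * y = y * w" for w
    proof -
      have "w * (x * x) = x * x * w"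
        by (metis S_D(4)[OF x w] mult.assoc)
      then show ?thesis
        using w by (simp add: distrib_left distrib_right)
    qed
  qed
  moreover have "dist ((1/2) *\<^sub>R (y + x * x)) ((1/2) *\<^sub>R (y + x' * x')) \<le> \<rho> * dist x x'"
    if "x \<in> S" "x' \<in> S" for x x'
  proof -
    have "norm (x * x - x' * x') = norm (x * (x - x') + (x - x') * x')"
      by (simp add: algebra_simps)
    also have "\<dots> \<le> norm x * norm (x - x') + norm (x - x') * norm x'"
      by (intro norm_triangle_le add_mono norm_mult_ineq)
    also have "\<dots> \<le> \<rho> * norm (x - x') + norm (x - x') * \<rho>"
      using S_D(1) that by (intro add_mono mult_mono) (auto simp: \<rho>)
    finally show ?thesis
      by (simp add: dist_norm flip: scaleR_diff_right)
  qed
  ultimately have "\<exists>!x\<in>S. (1/2) *\<^sub>R (y + x * x) = x"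
    by (intro Banach_fix[where c = \<rho>]) (use \<rho> in auto)
  then obtain x where x: "x \<in> S" "(1/2) *\<^sub>R (y + x * x) = x"
    by blast
  have "y + x * x = 2 *\<^sub>R ((1/2) *\<^sub>R (y + x * x))"
    by simp
  then have xx: "y + x * x = x + x"
    unfolding x(2) by (simp add: scaleR_2)
  show thesis
  proof
    show "1 - x \<in> C" "star (1 - x) = 1 - x" "norm (1 - (1 - x)) < 1"
      using S_D(1-3)[OF x(1)] \<rho> by (auto simp: subalgebra star_simps)
    show "(1 - x) * (1 - x) = 1 - y"
      using xx by (simp add: algebra_simps)
    show "w * (1 - x) = (1 - x) * w" if "w * y = y * w" for w
      using S_D(4)[OF x(1) that] by (simp add: algebra_simps)
  qed
qed

end

text \<open>The element \<open>u = h + \<i> k\<close> satisfies \<open>u\<^sup>* u = s\<close>, and \<open>h\<close> is its real part.\<close>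

lemma norm_le_of_square_sum:
  fixes h k :: "'a::cstar_algebra_1"
  assumes sa: "star h = h" "star k = k" and hk: "h * k = k * h"
    and s: "h * h + k * k = s *\<^sub>R 1" "0 \<le> s"
  shows "(norm h)\<^sup>2 \<le> s"
proof -
  define u where "u = h + \<i> *\<^sub>C k"
  have su: "star u = h - \<i> *\<^sub>C k"
    by (simp add: u_def star_simps star_scaleC sa scaleC_minus_left)
  have "star u * u = h * h + k * k"
    unfolding su unfolding u_def
    by (simp add: algebra_simps mult_scaleC_left mult_scaleC_right scaleC_diff_right scaleC_scaleC
        scaleC_minus_left scaleC_one hk)
  then have "(norm u)\<^sup>2 = s"
    using cstar_identity[of u] s by simp
  then have "norm u = sqrt s"
    by (simp add: real_sqrt_unique)
  have "2 *\<^sub>R h = u + star u"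
    unfolding su unfolding u_def by (simp add: scaleR_2)
  then have "2 * norm h \<le> norm u + norm (star u)"
    by (metis norm_scaleR norm_triangle_ineq abs_numeral)
  then have "norm h \<le> sqrt s"
    using \<open>norm u = sqrt s\<close> by simp
  then show ?thesis
    using power_mono[of "norm h" "sqrt s" 2] s(2) by simp
qed

section \<open>Positivity in terms of the norm\<close>

text \<open>A spectrum-free form of positivity, under which the cone is obviously convex and square
  roots come from a fixed point argument.\<close>

definition nonneg :: "'a::cstar_algebra_1 \<Rightarrow> bool" where
  "nonneg a \<longleftrightarrow> star a = a \<and> (\<exists>t\<ge>0. norm (t *\<^sub>R 1 - a) \<le> t)"

lemma nonneg_self_adjoint: "nonneg a \<Longrightarrow> star a = a"
  by (simp add: nonneg_def)

lemma nonneg_scaleR_one: "0 \<le> t \<Longrightarrow> nonneg (t *\<^sub>R 1)"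
  by (auto simp: nonneg_def star_simps)

lemma nonneg_diff: "star a = a \<Longrightarrow> norm a \<le> t \<Longrightarrow> nonneg (t *\<^sub>R 1 - a)"
  using norm_ge_zero[of a] unfolding nonneg_def
  by (intro conjI exI[of _ t]) (auto simp: star_simps simp del: norm_ge_zero)

lemma nonneg_add:
  assumes "nonneg a" "nonneg b"
  shows "nonneg (a + b)"
proof -
  from assms obtain s t where "0 \<le> s" "0 \<le> t" "norm (s *\<^sub>R 1 - a) \<le> s" "norm (t *\<^sub>R 1 - b) \<le> t"
    by (auto simp: nonneg_def)
  then have "norm ((s + t) *\<^sub>R 1 - (a + b)) \<le> s + t"
    using norm_triangle_ineq[of "s *\<^sub>R 1 - a" "t *\<^sub>R 1 - b"] by (simp add: algebra_simps)
  then show ?thesis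
    using assms \<open>0 \<le> s\<close> \<open>0 \<le> t\<close> by (auto simp: nonneg_def star_simps intro!: exI[of _ "s + t"])
qed

lemma nonneg_scaleR:
  assumes "nonneg a" "0 \<le> c"
  shows "nonneg (c *\<^sub>R a)"
proof -
  from assms obtain s where s: "0 \<le> s" "norm (s *\<^sub>R 1 - a) \<le> s"
    by (auto simp: nonneg_def)
  have "norm ((c * s) *\<^sub>R 1 - c *\<^sub>R a) = c * norm (s *\<^sub>R 1 - a)"
    using assms(2) by (simp flip: scaleR_diff_right scaleR_scaleR)
  then show ?thesis
    using assms s by (auto simp: nonneg_def star_simps mult_left_mono intro!: exI[of _ "c * s"])
qed

text \<open>If \<open>k\<close> is a square root of \<open>1 - (1/t) *\<^sub>R (h * h)\<close>, then
  the squares of \<open>h\<close> and \<open>sqrt t *\<^sub>R k\<close> add up to \<open>t\<close>.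
  By \<open>norm_le_of_square_sum\<close> the second square, which is the difference in question,
  has norm at most \<open>t\<close>.\<close>

lemma norm_diff_square_le:
  fixes h :: "'a::cstar_algebra_1"
  assumes "star h = h" "(norm h)\<^sup>2 < t"
  shows "norm (t *\<^sub>R 1 - h * h) \<le> t"
proof -
  have t: "0 < t"
    using assms(2) le_less_trans zero_le_power2 by blast
  have n: "norm ((1/t) *\<^sub>R (h * h)) < 1"
    using assms t by (simp add: norm_square_self_adjoint)
  have sa: "star ((1/t) *\<^sub>R (h * h)) = (1/t) *\<^sub>R (h * h)"
    by (simp add: star_simps assms(1))
  obtain k where k: "star k = k" "k * k = 1 - (1/t) *\<^sub>R (h * h)"
    "\<And>w. w * ((1/t) *\<^sub>R (h * h)) = (1/t) *\<^sub>R (h * h) * w \<Longrightarrow> w * k = k * w"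
    using square_root_near_one[OF cstar_subalgebra_UNIV UNIV_I sa n] by blast
  have "h * k = k * h"
    by (rule k(3)) (simp add: mult.assoc)
  then have "(norm (sqrt t *\<^sub>R k))\<^sup>2 \<le> t"
    using t k(1,2) by (intro norm_le_of_square_sum[where k = h])
      (auto simp: star_simps assms(1) scaleR_right_diff_distrib)
  moreover have "t *\<^sub>R 1 - h * h = (sqrt t *\<^sub>R k) * (sqrt t *\<^sub>R k)"
    using t k(2) by (simp add: scaleR_right_diff_distrib)
  ultimately show ?thesis
    using t k(1) by (simp add: norm_square_self_adjoint power_mult_distrib)
qed

lemma nonneg_square: "star h = h \<Longrightarrow> nonneg (h * h)"
  using norm_diff_square_le[of h "(norm h)\<^sup>2 + 1"]
  by (auto simp: nonneg_def star_simps intro!: exI[of _ "(norm h)\<^sup>2 + 1"])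

text \<open>Scaled by \<open>M = t + \<delta>\<close>, the shifted element becomes
  \<open>1 - y\<close> with \<open>norm y \<le> t / M\<close>. The shift makes this bound less than
  1, as the fixed point argument requires.\<close>

lemma nonneg_square_root:
  fixes a :: "'a::cstar_algebra_1"
  assumes "cstar_subalgebra C" "a \<in> C" "nonneg a" "0 < \<delta>"
  obtains h where "h \<in> C" "star h = h" "nonneg h" "h * h = a + \<delta> *\<^sub>R 1"
    "\<And>w. w * a = a * w \<Longrightarrow> w * h = h * w"
proof -
  from assms(3) obtain t where t: "0 \<le> t" "norm (t *\<^sub>R 1 - a) \<le> t" and sa: "star a = a"
    by (auto simp: nonneg_def)
  define M where "M = t + \<delta>"
  define y where "y = 1 - (1/M) *\<^sub>R (a + \<delta> *\<^sub>R 1)"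
  have M: "0 < M" "t < M"
    using t(1) assms(4) by (auto simp: M_def)
  have "y = (1/M) *\<^sub>R (M *\<^sub>R 1 - (a + \<delta> *\<^sub>R 1))"
    using M by (simp add: y_def scaleR_right_diff_distrib)
  also have "M *\<^sub>R 1 - (a + \<delta> *\<^sub>R 1) = t *\<^sub>R 1 - a"
    by (simp add: M_def algebra_simps)
  finally have y: "y = (1/M) *\<^sub>R (t *\<^sub>R 1 - a)" .
  then have "norm y < 1"
    using t M by simp
  moreover have "y \<in> C" "star y = y"
    using assms(2) sa by (simp_all add: y_def subalgebra[OF assms(1)] star_simps)
  ultimately obtain h where h: "h \<in> C" "star h = h" "h * h = 1 - y" "norm (1 - h) < 1"
    "\<And>w. w * y = y * w \<Longrightarrow> w * h = h * w"
    using square_root_near_one[OF assms(1)] by blast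
  have "nonneg h"
    using h(2,4) by (auto simp: nonneg_def intro!: exI[of _ 1])
  show thesis
  proof
    show "sqrt M *\<^sub>R h \<in> C" "star (sqrt M *\<^sub>R h) = sqrt M *\<^sub>R h"
      using h(1,2) by (simp_all add: subalgebra[OF assms(1)] star_simps)
    show "nonneg (sqrt M *\<^sub>R h)"
      using \<open>nonneg h\<close> M by (intro nonneg_scaleR) auto
    show "(sqrt M *\<^sub>R h) * (sqrt M *\<^sub>R h) = a + \<delta> *\<^sub>R 1"
      using M by (simp add: h(3) y_def)
    show "w * (sqrt M *\<^sub>R h) = (sqrt M *\<^sub>R h) * w" if "w * a = a * w" for w
      using h(5)[of w] that by (simp add: y left_diff_distrib right_diff_distrib)
  qed
qed

text \<open>The existential \<open>t\<close> in \<open>nonneg\<close> can be any bound of the norm.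
  Taking \<open>norm a\<close> itself turns positivity into a closed condition.\<close>

lemma nonneg_norm_diff_le:
  fixes a :: "'a::cstar_algebra_1"
  assumes "nonneg a" "norm a \<le> s"
  shows "norm (s *\<^sub>R 1 - a) \<le> s"
proof (rule field_le_epsilon)
  fix \<epsilon> :: real
  assume \<epsilon>: "0 < \<epsilon>"
  then have third: "0 < \<epsilon>/3"
    by simp
  obtain h where h: "star h = h" "h * h = a + (\<epsilon>/3) *\<^sub>R 1"
    by (rule nonneg_square_root[OF cstar_subalgebra_UNIV UNIV_I assms(1) third]) blast
  have "(norm h)\<^sup>2 \<le> norm a + \<epsilon>/3"
    using norm_square_self_adjoint[OF h(1)] norm_triangle_ineq[of a "(\<epsilon>/3) *\<^sub>R 1"] \<epsilon> h(2) by simp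
  then have "norm ((s + 2*\<epsilon>/3) *\<^sub>R 1 - h * h) \<le> s + 2*\<epsilon>/3"
    using assms(2) \<epsilon> by (intro norm_diff_square_le) (auto simp: h)
  moreover have "s *\<^sub>R 1 - a = ((s + 2*\<epsilon>/3) *\<^sub>R 1 - h * h) - (\<epsilon>/3) *\<^sub>R 1"
  proof -
    have "(s + 2*\<epsilon>/3) *\<^sub>R (1::'a) = s *\<^sub>R 1 + (\<epsilon>/3) *\<^sub>R 1 + (\<epsilon>/3) *\<^sub>R 1"
      by (simp flip: scaleR_add_left)
    then show ?thesis
      by (simp add: h(2))
  qed
  ultimately show "norm (s *\<^sub>R 1 - a) \<le> s + \<epsilon>"
    using norm_triangle_ineq4[of "(s + 2*\<epsilon>/3) *\<^sub>R 1 - h * h" "(\<epsilon>/3) *\<^sub>R (1::'a)"] \<epsilon>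
    by simp
qed

lemma closed_nonneg: "closed {a :: 'a::cstar_algebra_1. nonneg a}"
proof -
  have "nonneg a \<longleftrightarrow> star a = a \<and> norm (norm a *\<^sub>R 1 - a) \<le> norm a" for a :: 'a
    by (meson nonneg_def nonneg_norm_diff_le norm_ge_zero order_refl)
  then have "{a :: 'a. nonneg a} = {a. star a = a} \<inter> {a. norm (norm a *\<^sub>R 1 - a) \<le> norm a}"
    by auto
  moreover have "closed {a :: 'a. star a = a}"
    by (rule closed_Collect_eq) (intro continuous_intros)+
  moreover have "closed {a :: 'a. norm (norm a *\<^sub>R 1 - a) \<le> norm a}"
    by (rule closed_Collect_le) (intro continuous_intros)+
  ultimately show ?thesis
    by (simp add: closed_Int)
qed

text \<open>The roots \<open>h\<close> and \<open>k\<close> of the shifted factors commute, so the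
  product of the shifted factors is the square of \<open>h * k\<close>. Then the shift tends to
  0.\<close>

lemma nonneg_mult:
  fixes a b :: "'a::cstar_algebra_1"
  assumes "nonneg a" "nonneg b" and ab: "a * b = b * a"
  shows "nonneg (a * b)"
proof -
  have *: "nonneg ((a + \<delta> *\<^sub>R 1) * (b + \<delta> *\<^sub>R 1))" if \<delta>: "0 < \<delta>" for \<delta>
  proof -
    obtain h where h: "star h = h" "h * h = a + \<delta> *\<^sub>R 1" "\<And>w. w * a = a * w \<Longrightarrow> w * h = h * w"
      using nonneg_square_root[OF cstar_subalgebra_UNIV UNIV_I assms(1) \<delta>] by blast
    obtain k where k: "star k = k" "k * k = b + \<delta> *\<^sub>R 1" "\<And>w. w * b = b * w \<Longrightarrow> w * k = k * w"
      using nonneg_square_root[OF cstar_subalgebra_UNIV UNIV_I assms(2) \<delta>] by blast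
    have hk: "h * k = k * h"
      using h(3) k(3) ab by metis
    then have "(h * h) * (k * k) = (h * k) * (h * k)"
      by (metis mult.assoc)
    then show ?thesis
      using nonneg_square[of "h * k"] h(1,2) k(1,2) hk by (simp add: star_simps)
  qed
  have "(\<lambda>n. (a + inverse (real (Suc n)) *\<^sub>R 1) * (b + inverse (real (Suc n)) *\<^sub>R 1))
      \<longlonglongrightarrow> (a + 0 *\<^sub>R 1) * (b + 0 *\<^sub>R 1)"
    by (intro tendsto_mult tendsto_add tendsto_scaleR tendsto_const LIMSEQ_inverse_real_of_nat)
  from closed_sequentially[OF closed_nonneg _ this] show ?thesis
    using * by simp
qed

text \<open>Up to small shifts, \<open>a\<close> and \<open>M *\<^sub>R 1 - a\<close> are commuting
  squares with scalar sum, so \<open>norm_le_of_square_sum\<close> applies.\<close>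

lemma norm_le_of_nonneg_diff:
  fixes a :: "'a::cstar_algebra_1"
  assumes "nonneg a" "nonneg (M *\<^sub>R 1 - a)" "0 \<le> M"
  shows "norm a \<le> M"
proof (rule field_le_epsilon)
  fix \<epsilon> :: real
  assume \<epsilon>: "0 < \<epsilon>"
  then have third: "0 < \<epsilon>/3"
    by simp
  obtain h where h: "star h = h" "h * h = a + (\<epsilon>/3) *\<^sub>R 1" "\<And>w. w * a = a * w \<Longrightarrow> w * h = h * w"
    by (rule nonneg_square_root[OF cstar_subalgebra_UNIV UNIV_I assms(1) third]) blast
  obtain k where k: "star k = k" "k * k = M *\<^sub>R 1 - a + (\<epsilon>/3) *\<^sub>R 1"
      "\<And>w. w * (M *\<^sub>R 1 - a) = (M *\<^sub>R 1 - a) * w \<Longrightarrow> w * k = k * w"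
    by (rule nonneg_square_root[OF cstar_subalgebra_UNIV UNIV_I assms(2) third]) blast
  have "a * h = h * a"
    by (rule h(3)) simp
  then have hk: "h * k = k * h"
    by (intro k(3)) (simp add: algebra_simps)
  have "h * h + k * k = (M + 2*\<epsilon>/3) *\<^sub>R 1"
  proof -
    have "(M + 2*\<epsilon>/3) *\<^sub>R (1::'a) = M *\<^sub>R 1 + (\<epsilon>/3) *\<^sub>R 1 + (\<epsilon>/3) *\<^sub>R 1"
      by (simp flip: scaleR_add_left)
    then show ?thesis
      by (simp add: h(2) k(2))
  qed
  then have "(norm h)\<^sup>2 \<le> M + 2*\<epsilon>/3"
    using h(1) k(1) hk \<epsilon> assms(3) by (intro norm_le_of_square_sum) auto
  then have "norm (a + (\<epsilon>/3) *\<^sub>R 1) \<le> M + 2*\<epsilon>/3"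
    using norm_square_self_adjoint[OF h(1)] h(2) by simp
  moreover have "norm ((\<epsilon>/3) *\<^sub>R (1::'a)) = \<epsilon>/3"
    using \<epsilon> by simp
  ultimately show "norm a \<le> M + \<epsilon>"
    using norm_triangle_ineq4[of "a + (\<epsilon>/3) *\<^sub>R 1" "(\<epsilon>/3) *\<^sub>R (1::'a)"] by simp
qed

text \<open>The same scaling as for the square root reduces this to a Neumann inverse;
  \<open>1 - norm y \<ge> \<delta> / M\<close> yields the norm bound.\<close>

lemma inverse_nonneg_add:
  fixes a :: "'a::cstar_algebra_1"
  assumes "cstar_subalgebra C" "a \<in> C" "nonneg a" "0 < \<delta>"
  obtains i where "i \<in> C" "(a + \<delta> *\<^sub>R 1) * i = 1" "i * (a + \<delta> *\<^sub>R 1) = 1" "norm i \<le> 1 / \<delta>"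
proof -
  from assms(3) obtain t where t: "0 \<le> t" "norm (t *\<^sub>R 1 - a) \<le> t"
    by (auto simp: nonneg_def)
  define M where "M = t + \<delta>"
  have M: "0 < M" "t < M"
    using t(1) assms(4) by (auto simp: M_def)
  define y where "y = (1/M) *\<^sub>R (t *\<^sub>R 1 - a)"
  have ny: "norm y \<le> t / M"
    using t M by (simp add: y_def divide_right_mono)
  then have "norm y < 1"
    using M by (smt (verit) divide_less_eq_1)
  moreover have "y \<in> C"
    using assms(2) by (simp add: y_def subalgebra[OF assms(1)])
  ultimately obtain z where z: "z \<in> C" "(1 - y) * z = 1" "z * (1 - y) = 1" "norm z \<le> 1 / (1 - norm y)"
    using neumann_inverse[OF assms(1)] by blast
  have "M *\<^sub>R y = t *\<^sub>R 1 - a"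
    using M by (simp add: y_def)
  then have eq: "a + \<delta> *\<^sub>R 1 = M *\<^sub>R (1 - y)"
    by (simp add: scaleR_right_diff_distrib M_def scaleR_add_left)
  have "1 / (1 - norm y) \<le> 1 / (1 - t / M)"
    using ny M by (intro frac_le) (auto simp: field_simps)
  also have "1 / (1 - t / M) = M / \<delta>"
    using M assms(4) by (simp add: M_def field_simps)
  finally have "norm z \<le> M / \<delta>"
    using z(4) by linarith
  then have "norm ((1/M) *\<^sub>R z) \<le> 1 / \<delta>"
    using M assms(4) by (simp add: field_simps)
  then show thesis
    using z M by (intro that[of "(1/M) *\<^sub>R z"]) (auto simp: eq subalgebra[OF assms(1)])
qed

lemma inverse_self_adjoint:
  fixes b c :: "'a::cstar_algebra_1"
  assumes "b * c = 1" "c * b = 1" "star b = b"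
  shows "star c = c"
proof -
  have "star c * b = 1"
    using assms(1,3) star_mult[of b c] by simp
  then show ?thesis
    by (metis assms(1) mult.assoc mult.left_neutral mult.right_neutral)
qed

lemma invertibleI:
  fixes x :: "'a::cstar_algebra_1"
  assumes "x * y = 1" "z * x = 1"
  shows "invertible_in UNIV x"
proof -
  have "z = y"
    by (metis assms mult.assoc mult.left_neutral mult.right_neutral)
  then show ?thesis
    using assms by (auto simp: invertible_in_def)
qed

lemma invertible_uminus: "invertible_in UNIV x \<Longrightarrow> invertible_in UNIV (- x :: 'a::cstar_algebra_1)"
  by (auto simp: invertible_in_def intro: exI[of _ "- y" for y])

section \<open>Positivity and the spectrum\<close>

text \<open>The difference is a positive multiple of \<open>a * (norm c *\<^sub>R 1 - c)\<close>, a
  product of commuting nonnegative elements.\<close>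

lemma nonneg_invertible_bound:
  fixes a c :: "'a::cstar_algebra_1"
  assumes "nonneg a" "a * c = 1" "c * a = 1"
  shows "0 < norm c" "nonneg (a - (1 / norm c) *\<^sub>R 1)"
proof -
  show c: "0 < norm c"
    using assms(2) by auto
  have "nonneg (norm c *\<^sub>R 1 - c)"
    using inverse_self_adjoint[OF assms(2,3)] assms(1) by (simp add: nonneg_diff nonneg_self_adjoint)
  then have "nonneg (a * (norm c *\<^sub>R 1 - c))"
    using assms by (intro nonneg_mult) (auto simp: algebra_simps)
  then have "nonneg ((1 / norm c) *\<^sub>R (a * (norm c *\<^sub>R 1 - c)))"
    by (intro nonneg_scaleR) auto
  moreover have "(1 / norm c) *\<^sub>R (a * (norm c *\<^sub>R 1 - c)) = a - (1 / norm c) *\<^sub>R 1"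
    using c assms(2) by (simp add: right_diff_distrib scaleR_right_diff_distrib)
  ultimately show "nonneg (a - (1 / norm c) *\<^sub>R 1)"
    by simp
qed

text \<open>Otherwise the square of \<open>norm k\<close> minus \<open>k * k\<close> would be
  nonnegative and invertible, hence bounded below by some \<open>1 / K\<close>, and
  \<open>norm (k * k)\<close> would be strictly less than the square of
  \<open>norm k\<close>.\<close>

lemma norm_in_spectrum:
  fixes k :: "'a::cstar_algebra_1"
  assumes "star k = k" "k \<noteq> 0"
  shows "\<not> invertible_in UNIV (norm k *\<^sub>R 1 - k) \<or> \<not> invertible_in UNIV (norm k *\<^sub>R 1 + k)"
proof (rule ccontr)
  let ?L = "norm k"
  assume "\<not> ?thesis"
  then obtain c d where c: "(?L *\<^sub>R 1 - k) * c = 1" "c * (?L *\<^sub>R 1 - k) = 1"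
    and d: "(?L *\<^sub>R 1 + k) * d = 1" "d * (?L *\<^sub>R 1 + k) = 1"
    by (auto simp: invertible_in_def)
  define a where "a = (?L)\<^sup>2 *\<^sub>R 1 - k * k"
  have a: "a = (?L *\<^sub>R 1 - k) * (?L *\<^sub>R 1 + k)" "a = (?L *\<^sub>R 1 + k) * (?L *\<^sub>R 1 - k)"
    by (simp_all add: a_def algebra_simps power2_eq_square)
  have kk: "star (k * k) = k * k" "norm (k * k) = ?L\<^sup>2"
    using assms(1) by (simp_all add: star_simps norm_square_self_adjoint)
  then have "nonneg a"
    by (simp add: a_def nonneg_diff)
  have ac: "a * (d * c) = 1"
    unfolding a(1) by (metis c(1) d(1) mult.assoc mult.right_neutral)
  have ca: "(d * c) * a = 1"
    unfolding a(1) by (metis c(2) d(2) mult.assoc mult.right_neutral)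
  define K where "K = norm (d * c)"
  have K: "0 < K" "nonneg (a - (1 / K) *\<^sub>R 1)"
    using nonneg_invertible_bound[OF \<open>nonneg a\<close> ac ca] by (simp_all add: K_def)
  have "norm a \<le> ?L\<^sup>2"
    using nonneg_norm_diff_le[OF nonneg_square[OF assms(1)], of "?L\<^sup>2"] kk by (simp add: a_def)
  moreover have "1 \<le> norm a * K"
    using norm_mult_ineq[of a "d * c"] ac by (simp add: K_def)
  ultimately have "1 / K \<le> ?L\<^sup>2"
    using K(1) by (smt (verit) mult_right_mono pos_divide_le_eq)
  moreover have "nonneg ((?L\<^sup>2 - 1 / K) *\<^sub>R 1 - k * k)"
    using K(2) by (simp add: a_def scaleR_diff_left algebra_simps)
  ultimately have "norm (k * k) \<le> ?L\<^sup>2 - 1 / K"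
    by (intro norm_le_of_nonneg_diff nonneg_square) (auto simp: assms(1))
  then show False
    using kk K(1) by simp
qed

lemma of_real_scaleC: "complex_of_real r *\<^sub>C x = r *\<^sub>R (x :: 'a::cstar_algebra_1)"
  by (simp add: scaleR_scaleC)

text \<open>If \<open>k = norm g *\<^sub>R 1 - g\<close> had norm greater than
  \<open>norm g\<close>, neither sign of \<open>norm k\<close> could be spectral for
  \<open>k\<close>: the positive one would make \<open>norm g - norm k < 0\<close> spectral for
  \<open>g\<close>, and the negative one is excluded because \<open>k\<close> is
  nonnegative.\<close>

lemma nonneg_of_positive:
  fixes g :: "'a::cstar_algebra_1"
  assumes "g \<in> positive_of C"
  shows "nonneg g"
proof -
  have sa: "star g = g"
    using assms by (simp add: positive_of_def self_adjoint_of_def)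
  have inv: "invertible_in UNIV (r *\<^sub>R 1 - g)" if "r < 0" for r
  proof -
    have "complex_of_real r \<notin> complex_of_real ` {0..}"
      using that by auto
    then have "complex_of_real r \<notin> spectrum_in C g"
      using assms by (auto simp: positive_of_def)
    then show ?thesis
      by (auto simp: spectrum_in_def invertible_in_def of_real_scaleC)
  qed
  define k where "k = norm g *\<^sub>R 1 - g"
  have k: "star k = k"
    by (simp add: k_def star_simps sa)
  have "norm k \<le> norm g"
  proof (rule ccontr)
    assume "\<not> ?thesis"
    then have L: "norm g < norm k"
      by simp
    have eq: "norm k *\<^sub>R 1 - k = - ((norm g - norm k) *\<^sub>R 1 - g)"
        "norm k *\<^sub>R 1 + k = (norm g *\<^sub>R 1 - g) + norm k *\<^sub>R 1"
      by (simp_all add: k_def scaleR_diff_left)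
    have "0 < norm k"
      using L norm_ge_zero[of g] by linarith
    then obtain i where "((norm g *\<^sub>R 1 - g) + norm k *\<^sub>R 1) * i = 1"
        "i * ((norm g *\<^sub>R 1 - g) + norm k *\<^sub>R 1) = 1"
      using inverse_nonneg_add[OF cstar_subalgebra_UNIV UNIV_I nonneg_diff[OF sa order_refl]] by metis
    then have "invertible_in UNIV (norm k *\<^sub>R 1 + k)"
      unfolding eq by (rule invertibleI)
    moreover have "invertible_in UNIV (norm k *\<^sub>R 1 - k)"
      unfolding eq using L by (intro invertible_uminus inv) simp
    moreover have "k \<noteq> 0"
      using \<open>0 < norm k\<close> by auto
    ultimately show False
      using norm_in_spectrum[OF k] by blast
  qed
  then show ?thesis
    unfolding nonneg_def k_def using sa norm_ge_zero[of g] by blast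
qed

lemma positive_of_nonneg:
  fixes a :: "'a::cstar_algebra_1"
  assumes "nonneg a"
  shows "a \<in> positive_of UNIV"
proof -
  have sa: "star a = a"
    using assms by (rule nonneg_self_adjoint)
  have "invertible_in UNIV (c *\<^sub>C 1 - a)" if c: "c \<notin> complex_of_real ` {0..}" for c
  proof (cases "Im c = 0")
    case True
    then have cr: "c = complex_of_real (Re c)"
      by (simp add: complex_eq_iff)
    with c have "Re c < 0"
      by (metis atLeast_iff imageI linorder_not_le)
    then obtain i where "(a + (- Re c) *\<^sub>R 1) * i = 1" "i * (a + (- Re c) *\<^sub>R 1) = 1"
      using inverse_nonneg_add[OF cstar_subalgebra_UNIV UNIV_I assms, of "- Re c"] by auto
    then have "invertible_in UNIV (- (a + (- Re c) *\<^sub>R 1))"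
      by (intro invertible_uminus invertibleI)
    moreover have "c *\<^sub>C 1 - a = - (a + (- Re c) *\<^sub>R 1)"
      by (subst cr) (simp add: of_real_scaleC)
    ultimately show ?thesis
      by simp
  next
    case False
    define k where "k = Re c *\<^sub>R 1 - a"
    have k: "star k = k"
      by (simp add: k_def star_simps sa)
    obtain i where i: "(k * k + (Im c)\<^sup>2 *\<^sub>R 1) * i = 1" "i * (k * k + (Im c)\<^sup>2 *\<^sub>R 1) = 1"
      using inverse_nonneg_add[OF cstar_subalgebra_UNIV UNIV_I nonneg_square[OF k], of "(Im c)\<^sup>2"] False
      by auto
    \<comment> \<open>For nonreal \<open>c\<close> the two factors \<open>k + ?z\<close> and
      \<open>k - ?z\<close> multiply to \<open>k * k\<close> plus a positive scalar, which is
      invertible.\<close>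
    let ?z = "\<i> * Im c"
    have "c *\<^sub>C 1 = Re c *\<^sub>R 1 + ?z *\<^sub>C (1::'a)"
      by (subst complex_eq[of c]) (simp add: scaleC_add_left of_real_scaleC)
    then have eq: "c *\<^sub>C 1 - a = k + ?z *\<^sub>C 1"
      by (simp add: k_def)
    have "- (?z * ?z) = complex_of_real ((Im c)\<^sup>2)"
      by (simp add: complex_eq_iff power2_eq_square)
    then have zz: "(- (?z * ?z)) *\<^sub>C (1::'a) = (Im c)\<^sup>2 *\<^sub>R 1"
      by (simp only: of_real_scaleC)
    have prod: "(k + ?z *\<^sub>C 1) * (k - ?z *\<^sub>C 1) = k * k + (Im c)\<^sup>2 *\<^sub>R 1"
        "(k - ?z *\<^sub>C 1) * (k + ?z *\<^sub>C 1) = k * k + (Im c)\<^sup>2 *\<^sub>R 1"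
      unfolding zz[symmetric]
      by (simp_all add: distrib_left distrib_right left_diff_distrib right_diff_distrib
          mult_scaleC_left mult_scaleC_right scaleC_add_right scaleC_diff_right scaleC_scaleC
          scaleC_minus_left)
    show ?thesis
      unfolding eq
    proof (rule invertibleI)
      show "(k + ?z *\<^sub>C 1) * ((k - ?z *\<^sub>C 1) * i) = 1"
        using prod(1) i(1) by (simp flip: mult.assoc)
      show "(i * (k - ?z *\<^sub>C 1)) * (k + ?z *\<^sub>C 1) = 1"
        using prod(2) i(2) by (simp add: mult.assoc)
    qed
  qed
  then show ?thesis
    using sa by (auto simp: positive_of_def self_adjoint_of_def spectrum_in_def)
qed

section \<open>Projections and real rank zero\<close>

definition projection :: "'a::cstar_algebra_1 \<Rightarrow> bool" where
  "projection p \<longleftrightarrow> p * p = p \<and> star p = p"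

lemma projection_compl: "projection p \<Longrightarrow> projection (1 - p)"
  by (simp add: projection_def algebra_simps star_simps)

lemma projection_diff:
  assumes "projection f" "projection p" "f * p = p"
  shows "projection (f - p)"
proof -
  have "p * f = p"
    using assms star_mult[of f p] by (simp add: projection_def)
  then show ?thesis
    using assms by (simp add: projection_def algebra_simps star_simps)
qed

lemma nonneg_projection: "projection p \<Longrightarrow> nonneg p"
  by (metis projection_def nonneg_square)

lemma norm_projection_le: "projection p \<Longrightarrow> norm p \<le> 1"
  using norm_square_self_adjoint[of p]
  by (auto simp: projection_def power2_eq_square)

lemma norm_mult_le_of_norm_le_one:
  fixes p x :: "'a::real_normed_algebra"
  assumes "norm p \<le> 1"
  shows "norm (p * x) \<le> norm x" "norm (x * p) \<le> norm x"
  using norm_mult_ineq[of p x] norm_mult_ineq[of x p]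
    mult_right_mono[OF assms, of "norm x"] mult_left_mono[OF assms, of "norm x"] by auto

lemmas norm_projection_mult_le = norm_mult_le_of_norm_le_one[OF norm_projection_le]

text \<open>Largeness asks for elements positive in \<open>B\<close> itself, so the resolvent has to
  lie in \<open>C\<close>. It is explicit: \<open>c *\<^sub>C 1 - r\<close> acts as \<open>c\<close>
  on \<open>1 - r\<close> and as \<open>c - 1\<close> on \<open>r\<close>.\<close>

lemma positive_of_projection:
  assumes C: "cstar_subalgebra C" and r: "r \<in> C" "projection r"
  shows "r \<in> positive_of C"
proof -
  have "c = 0 \<or> c = 1" if c: "c \<in> spectrum_in C r" for c
  proof (rule ccontr)
    assume "\<not> ?thesis"
    then have c01: "c \<noteq> 0" "c - 1 \<noteq> 0"
      by auto
    let ?i = "(1 / c) *\<^sub>C (1 - r) + (1 / (c - 1)) *\<^sub>C r"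
    have "?i \<in> C"
      using r by (intro subalgebra[OF C])
    have cr: "c *\<^sub>C 1 - r = c *\<^sub>C (1 - r) + (c - 1) *\<^sub>C r"
      using scaleC_add_left[of "c - 1" 1 r] by (simp add: scaleC_diff_right scaleC_one algebra_simps)
    have z: "(1 - r) * r = 0" "r * (1 - r) = 0" "(1 - r) * (1 - r) = 1 - r" "r * r = r"
      using r(2) by (simp_all add: projection_def algebra_simps)
    have zero: "d *\<^sub>C (0::'a) = 0" for d
      using scaleC_diff_right[of d 0 0] by simp
    have "(c *\<^sub>C 1 - r) * ?i = 1" "?i * (c *\<^sub>C 1 - r) = 1"
      unfolding cr using c01
      by (simp_all add: distrib_left distrib_right mult_scaleC_left mult_scaleC_right
          scaleC_scaleC z zero scaleC_one)
    moreover have "c *\<^sub>C 1 - r \<in> C"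
      using r(1) by (intro subalgebra[OF C])
    ultimately have "invertible_in C (c *\<^sub>C 1 - r)"
      unfolding invertible_in_def using \<open>?i \<in> C\<close> by blast
    then show False
      using c by (simp add: spectrum_in_def)
  qed
  then have "spectrum_in C r \<subseteq> complex_of_real ` {0..}"
    by (force intro: image_eqI[of _ _ 0] image_eqI[of _ _ 1])
  then show ?thesis
    using r by (simp add: positive_of_def self_adjoint_of_def projection_def)
qed

text \<open>Here \<open>m\<close> is the absolute value of \<open>b\<close>, the symmetry
  \<open>s = m * c\<close> is the sign of \<open>b\<close>, and
  \<open>p = (1 + s) / 2\<close>.\<close>

lemma spectral_projection:
  fixes b c :: "'a::cstar_algebra_1"
  assumes C: "cstar_subalgebra C" "b \<in> C" "c \<in> C"
    and b: "star b = b" "b * c = 1" "c * b = 1"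
  obtains p m where "p \<in> C" "m \<in> C" "projection p" "nonneg m" "m * p = p * m"
    "p * b = p * m" "(1 - p) * b = - ((1 - p) * m)"
    "\<And>w. w * b = b * w \<Longrightarrow> w * p = p * w" "\<And>w. w * b = b * w \<Longrightarrow> w * m = m * w"
proof -
  have c: "star c = c"
    using inverse_self_adjoint b by metis
  have bbcc: "b * b * (c * c) = 1" "c * c * (b * b) = 1"
    by (metis b mult.assoc mult.right_neutral)+
  \<comment> \<open>Invertibility bounds \<open>b * b\<close> below, so it is a nonnegative element
    plus a positive scalar and has an exact square root.\<close>
  define a where "a = b * b - (1 / norm (c * c)) *\<^sub>R 1"
  have a: "0 < 1 / norm (c * c)" "nonneg a"
    using nonneg_invertible_bound[OF nonneg_square[OF b(1)] bbcc] by (simp_all add: a_def)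
  have "a \<in> C"
    using C by (simp add: a_def subalgebra[OF C(1)])
  then obtain m where m: "m \<in> C" "star m = m" "nonneg m" "m * m = a + (1 / norm (c * c)) *\<^sub>R 1"
      "\<And>w. w * a = a * w \<Longrightarrow> w * m = m * w"
    by (rule nonneg_square_root[OF C(1) _ a(2,1)]) blast
  have mm: "m * m = b * b"
    by (simp add: m(4) a_def)
  have comm: "w * m = m * w" if "w * b = b * w" for w
  proof (rule m(5))
    have "w * (b * b) = b * b * w"
      by (metis that mult.assoc)
    then show "w * a = a * w"
      by (simp add: a_def algebra_simps)
  qed
  have bm: "b * m = m * b" and cm: "c * m = m * c"
    using b by (auto intro: comm)
  define s where "s = m * c"
  have ss: "s * s = 1"
    unfolding s_def by (metis cm mm bbcc(1) mult.assoc)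
  have "star s = s"
    by (simp add: s_def star_simps c m(2) cm)
  have sb: "s * b = m"
    by (simp add: s_def mult.assoc b)
  have sm: "s * m = b" "m * s = b"
    unfolding s_def by (metis mm b(2) cm mult.assoc mult.right_neutral)+
  define p where "p = (1/2) *\<^sub>R (1 + s)"
  show thesis
  proof
    show "p \<in> C" "m \<in> C" "nonneg m"
      using C m(1,3) by (simp_all add: p_def s_def subalgebra[OF C(1)])
    have "(1 + s) * (1 + s) = 2 *\<^sub>R (1 + s)"
      by (simp add: distrib_left distrib_right ss scaleR_2)
    then have "p * p = p"
      by (simp add: p_def)
    then show "projection p"
      using \<open>star s = s\<close> by (simp add: projection_def p_def star_simps)
    show "m * p = p * m" "p * b = p * m"
      by (simp_all add: p_def algebra_simps sb sm)
    have "p + (1/2) *\<^sub>R (1 - s) = 1"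
      using scaleR_half_double[of "1::'a"] by (simp add: p_def flip: scaleR_add_right)
    then have "1 - p = (1/2) *\<^sub>R (1 - s)"
      by (simp add: algebra_simps)
    then show "(1 - p) * b = - ((1 - p) * m)"
      by (simp add: left_diff_distrib sb sm flip: scaleR_minus_right)
    show "w * p = p * w" if "w * b = b * w" for w
    proof -
      have "w * c = c * w"
        using commute_inverse[OF b(2,3) that] .
      then have "w * s = s * w"
        unfolding s_def by (metis comm[OF that] mult.assoc)
      then show ?thesis
        by (simp add: p_def algebra_simps)
    qed
    show "w * m = m * w" if "w * b = b * w" for w
      using comm[OF that] .
  qed
qed

section \<open>Real rank zero in corners\<close>

lemma real_rank_zero_approx:
  assumes "real_rank_zero C" "x \<in> C" "star x = x" "0 < \<epsilon>"
  obtains b c where "b \<in> C" "star b = b" "c \<in> C" "b * c = 1" "c * b = 1" "norm (b - x) < \<epsilon>"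
proof -
  have "x \<in> closure {b \<in> self_adjoint_of C. invertible_in C b}"
    using assms(1-3) by (auto simp: real_rank_zero_def self_adjoint_of_def)
  then show thesis
    using assms(4) that by (auto simp: closure_approachable self_adjoint_of_def invertible_in_def dist_norm)
qed

text \<open>If \<open>b\<close> is an invertible element near \<open>x + (1 - f)\<close>, then its \<open>(1 - f)\<close>-corner is invertible
  as well, and the Schur complement of that corner is invertible in the \<open>f\<close>-corner with
  inverse \<open>f b\<^sup>-\<^sup>1 f\<close>.\<close>

lemma corner_real_rank_zero:
  fixes f :: "'a::cstar_algebra_1"
  assumes C: "cstar_subalgebra C" "real_rank_zero C"
    and f: "f \<in> C" "projection f" and x: "x \<in> C" "star x = x" "f * x = x" and \<eta>: "0 < \<eta>"
  obtains x' y where "x' \<in> C" "star x' = x'" "f * x' = x'" "x' * f = x'" "norm (x' - x) < \<eta>"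
    "y \<in> C" "f * y = y" "y * f = y" "x' * y = f" "y * x' = f"
proof -
  define e where "e = 1 - f"
  have ff: "f * f = f" "star f = f"
    using f(2) by (simp_all add: projection_def)
  have pe: "projection e"
    using f(2) by (simp add: e_def projection_compl)
  then have e: "e * e = e" "star e = e"
    by (simp_all add: projection_def)
  have ef: "e * f = 0" "f * e = 0"
    by (simp_all add: e_def algebra_simps ff)
  have xf: "x * f = x"
    using x(2,3) star_mult[of f x] ff by simp
  have xe: "e * x = 0" "x * e = 0"
    by (simp_all add: e_def algebra_simps x(3) xf)
  \<comment> \<open>The bound 1/2 makes the \<open>e\<close>-corner of \<open>b\<close> invertible
    with inverse \<open>k\<close> of norm at most 2; the bound \<open>\<eta>/2\<close> then serves
    the final estimate.\<close>
  define \<eta>1 where "\<eta>1 = min (\<eta>/2) (1/2)"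
  have \<eta>1: "0 < \<eta>1" "\<eta>1 \<le> \<eta>/2" "\<eta>1 \<le> 1/2"
    using \<eta> by (auto simp: \<eta>1_def)
  have eC: "e \<in> C"
    using f by (simp add: e_def subalgebra[OF C(1)])
  obtain b c where b: "b \<in> C" "star b = b" "c \<in> C" "b * c = 1" "c * b = 1" "norm (b - (x + e)) < \<eta>1"
    using real_rank_zero_approx[OF C(2) _ _ \<eta>1(1), of "x + e"] x eC e
    by (auto simp: subalgebra[OF C(1)] star_simps)
  have c: "star c = c"
    using inverse_self_adjoint b by metis
  define d where "d = b - (x + e)"
  have bd: "b = x + e + d"
    by (simp add: d_def)
  have d: "norm d < \<eta>1" "d \<in> C"
    using b eC x by (simp_all add: d_def subalgebra[OF C(1)])
  note le = norm_projection_mult_le[OF pe] norm_projection_mult_le[OF f(2)]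
  have n: "norm (f * d * f) \<le> norm d" "norm (f * d * e) \<le> norm d" "norm (e * d * f) \<le> norm d"
      "norm (e * d * e) \<le> norm d"
    using le order_trans by meson+
  have "norm (- (e * d * e)) < 1"
    using n(4) d \<eta>1 by simp
  then obtain z where z: "z \<in> C" "z * (1 + e * d * e) = 1" "(1 + e * d * e) * z = 1" "norm z \<le> 1 / (1 - norm (e * d * e))"
    using neumann_inverse[OF C(1), of "- (e * d * e)"] eC d by (auto simp: subalgebra[OF C(1)])
  have "1 / (1 - norm (e * d * e)) \<le> 1 / (1 / 2)"
    using n(4) d \<eta>1 by (intro frac_le) auto
  then have z2: "norm z \<le> 2"
    using z(4) by simp
  have ebe: "e * b * e = (1 + e * d * e) * e"
    by (simp add: bd distrib_left distrib_right xe e mult.assoc)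
  have zb: "z * (e * b * e) = e"
    unfolding ebe by (metis z(2) mult.assoc mult.left_neutral)
  define k where "k = e * z * e"
  have kb: "k * (e * b * e) = e"
  proof -
    have "k * (e * b * e) = e * (z * (e * e * b * e))"
      by (simp add: k_def mult.assoc)
    then show ?thesis
      by (simp add: e zb)
  qed
  have k2: "norm k \<le> 2"
    unfolding k_def using le z2 order_trans by meson
  \<comment> \<open>\<open>x'\<close> is the Schur complement of the \<open>e\<close>-corner of
    \<open>b\<close>. It differs from \<open>x\<close> by \<open>f * d * f\<close> and a term
    quadratic in \<open>d\<close>.\<close>
  define x' where "x' = f * b * f - f * b * e * k * (e * b * f)"
  define y where "y = f * c * f"
  have "star d = d"
    by (simp add: d_def star_simps b x e)
  then have "star (1 + e * d * e) = 1 + e * d * e"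
    by (simp add: star_simps e mult.assoc)
  then have "star z = z"
    using inverse_self_adjoint z(2,3) by metis
  then have k: "star k = k" "k \<in> C"
    using z(1) eC by (simp_all add: k_def star_simps e mult.assoc subalgebra[OF C(1)])
  have sx': "star x' = x'"
    by (simp add: x'_def star_simps b ff e k mult.assoc)
  have "x' - x = f * d * f - f * d * e * k * (e * d * f)"
    by (simp add: x'_def bd distrib_left distrib_right x(3) xf xe ef e flip: mult.assoc)
  also have "norm \<dots> \<le> norm (f * d * f) + norm (f * d * e * k) * norm (e * d * f)"
    by (rule order_trans[OF norm_triangle_ineq4]) (simp add: norm_mult_ineq)
  also have "\<dots> \<le> norm d + (norm d * 2) * (1/2)"
    using n k2 d(1) \<eta>1(3)
    by (intro add_mono mult_mono order_trans[OF norm_mult_ineq[of "f * d * e" k]]) auto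
  also have "\<dots> < \<eta>"
    using d(1) \<eta>1(2) by simp
  finally have nx: "norm (x' - x) < \<eta>" .
  have bfc: "b * (f * f) * c = 1 - b * e * c"
    unfolding ff by (simp add: e_def algebra_simps b)
  have 1: "f * b * f * y = f - f * b * e * c * f"
  proof -
    have "f * b * f * y = f * (b * (f * f) * c) * f"
      by (simp add: y_def mult.assoc)
    then show ?thesis
      unfolding bfc by (simp add: algebra_simps ff mult.assoc)
  qed
  have 2: "k * (e * b * f) * y = - (e * c * f)"
  proof -
    have "k * (e * b * f) * y = k * e * (b * (f * f) * c) * f"
      by (simp add: y_def mult.assoc)
    also have "\<dots> = k * (e * f) - k * (e * b * e) * c * f"
      unfolding bfc by (simp add: algebra_simps mult.assoc)
    finally show ?thesis
      by (simp add: kb ef)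
  qed
  have "x' * y = f * b * f * y - f * b * e * (k * (e * b * f) * y)"
    by (simp add: x'_def algebra_simps mult.assoc)
  also have "\<dots> = f - f * b * e * c * f + f * b * (e * e) * c * f"
    unfolding 1 2 by (simp add: mult.assoc)
  also have "\<dots> = f"
    by (simp add: e)
  finally have xy: "x' * y = f" .
  have sy: "star y = y"
    by (simp add: y_def star_simps c ff mult.assoc)
  have yx: "y * x' = f"
    using arg_cong[OF xy, of star] by (simp add: star_simps sx' sy ff)
  have "x' \<in> C" "y \<in> C"
    using f(1) b(1,3) k eC by (simp_all add: x'_def y_def subalgebra[OF C(1)])
  moreover have "f * x' = x'" "f * y = y"
    by (simp_all add: x'_def y_def algebra_simps ff flip: mult.assoc)
  moreover from this have "x' * f = x'" "y * f = y"
    using star_mult[of f x'] star_mult[of f y] sx' sy ff by simp_all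
  ultimately show thesis
    using that sx' nx xy yx by blast
qed

text \<open>Think of \<open>p\<close> as a spectral projection of \<open>G\<close> for the interval above \<open>\<delta>\<close>, and of \<open>j\<close> as the
  inverse of \<open>G\<close> there. It is the positive spectral projection of an invertible element near
  \<open>G - \<delta> f\<close>.\<close>

lemma real_rank_zero_projection:
  fixes f G :: "'a::cstar_algebra_1"
  assumes C: "cstar_subalgebra C" "real_rank_zero C"
    and f: "f \<in> C" "projection f" and G: "G \<in> C" "star G = G" "f * G = G"
    and t: "norm (t *\<^sub>R f - G) \<le> t" and \<delta>: "0 < \<delta>" and \<eta>: "0 < \<eta>"
  obtains p j where "p \<in> C" "projection p" "f * p = p" "j \<in> C" "p * j = j" "j * p = j"
    "norm (j * G - p) \<le> \<eta> / \<delta>" "norm j \<le> 1 / \<delta>" "norm ((f - p) * G) \<le> 2 * \<delta> + 2 * \<eta>"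
proof -
  have t0: "0 \<le> t"
    using t norm_ge_zero order_trans by blast
  have ff: "f * f = f" "star f = f"
    using f(2) by (simp_all add: projection_def)
  have Gf: "G * f = G"
    using G(2,3) star_mult[of f G] ff by simp
  obtain b' c' where b': "b' \<in> C" "star b' = b'" "f * b' = b'" "b' * f = b'"
      "norm (b' - (G - \<delta> *\<^sub>R f)) < \<eta>"
    and c': "c' \<in> C" "f * c' = c'" "c' * f = c'" "b' * c' = f" "c' * b' = f"
    using corner_real_rank_zero[OF C f _ _ _ \<eta>, of "G - \<delta> *\<^sub>R f"] f(1) G
    by (simp add: subalgebra[OF C(1)] star_simps ff right_diff_distrib) blast
  define e where "e = 1 - f"
  have e: "e \<in> C" "star e = e" "e * e = e" "e * f = 0" "f * e = 0"
    using f(1) by (simp_all add: e_def subalgebra[OF C(1)] star_simps ff algebra_simps)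
  have be: "e * b' = 0" "b' * e = 0" "e * c' = 0" "c' * e = 0"
    using b' c' by (simp_all add: e_def algebra_simps)
  \<comment> \<open>The summand \<open>- e\<close> completes \<open>b'\<close> to an invertible
    element that is negative on the complement of \<open>f\<close>, which forces the positive
    spectral projection below \<open>f\<close>.\<close>
  have inv: "(b' - e) * (c' - e) = 1" "(c' - e) * (b' - e) = 1"
    by (simp_all add: left_diff_distrib right_diff_distrib be c' e(3)) (simp_all add: e_def)
  have bc: "b' - e \<in> C" "c' - e \<in> C" "star (b' - e) = b' - e"
    using b' c' e by (simp_all add: subalgebra[OF C(1)] star_simps)
  obtain p m where pm: "p \<in> C" "m \<in> C" "projection p" "nonneg m" "m * p = p * m"
      "p * (b' - e) = p * m" "(1 - p) * (b' - e) = - ((1 - p) * m)"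
    and comm: "\<And>w. w * (b' - e) = (b' - e) * w \<Longrightarrow> w * p = p * w"
      "\<And>w. w * (b' - e) = (b' - e) * w \<Longrightarrow> w * m = m * w"
    by (rule spectral_projection[OF C(1) bc inv]) blast
  have pp: "p * p = p" "star p = p"
    using pm(3) by (simp_all add: projection_def)
  have ee: "e * (b' - e) = (b' - e) * e"
    by (simp add: left_diff_distrib right_diff_distrib be)
  have ep: "e * p = p * e" and em: "e * m = m * e"
    using comm[OF ee] .
  have "e * p = 0"
  proof -
    obtain i where i: "(m + 1 *\<^sub>R 1) * i = 1"
      using inverse_nonneg_add[OF C(1) pm(2,4) zero_less_one] by metis
    have "e * (p * m) = p * (e * (b' - e))"
      by (metis pm(6) ep mult.assoc)
    also have "\<dots> = - (e * p)"
      by (simp add: right_diff_distrib be e ep)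
    finally have "e * p * (m + 1 *\<^sub>R 1) = 0"
      by (simp add: distrib_left mult.assoc)
    then have "e * p * ((m + 1 *\<^sub>R 1) * i) = 0"
      by (metis mult.assoc mult_zero_left)
    then show ?thesis
      unfolding i by simp
  qed
  then have ep0: "e * p = 0" "p * e = 0"
    by (simp_all add: ep)
  then have fp: "f * p = p" "p * f = p"
    by (simp_all add: e_def algebra_simps)
  define E where "E = (G - \<delta> *\<^sub>R f) - b'"
  have E: "norm E \<le> \<eta>"
    using b'(5) by (simp add: E_def norm_minus_commute)
  have GE: "G = E + \<delta> *\<^sub>R f + b'"
    by (simp add: E_def)
  have pb: "p * b' = p * m"
    using pm(6) ep0 by (simp add: right_diff_distrib)
  obtain i where i: "i \<in> C" "(m + \<delta> *\<^sub>R 1) * i = 1" "i * (m + \<delta> *\<^sub>R 1) = 1" "norm i \<le> 1 / \<delta>"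
    using inverse_nonneg_add[OF C(1) pm(2,4) \<delta>] .
  have "p * (m + \<delta> *\<^sub>R 1) = (m + \<delta> *\<^sub>R 1) * p"
    by (simp add: algebra_simps pm(5))
  then have pi: "p * i = i * p"
    using commute_inverse[OF i(2,3)] by blast
  \<comment> \<open>Under \<open>p\<close> the element \<open>G\<close> is
    \<open>m + \<delta> *\<^sub>R 1\<close> up to the error \<open>E\<close>, so \<open>j\<close>
    nearly inverts it there.\<close>
  define j where "j = i * p"
  have "j * G = i * (p * E) + i * (m + \<delta> *\<^sub>R 1) * p"
    by (simp add: j_def GE distrib_left distrib_right mult.assoc pb fp pm(5))
  then have "j * G - p = j * E"
    by (simp add: i j_def mult.assoc)
  moreover have nj: "norm j \<le> 1 / \<delta>"
    unfolding j_def using norm_projection_mult_le(2)[OF pm(3)] i(4) order_trans by blast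
  moreover have "norm (j * E) \<le> (1 / \<delta>) * \<eta>"
    using nj E \<delta> norm_mult_ineq[of j E] by (smt (verit) mult_mono norm_ge_zero divide_nonneg_pos)
  ultimately have jG: "norm (j * G - p) \<le> \<eta> / \<delta>"
    by simp
  define n where "n = f - p"
  have pn: "projection n"
    unfolding n_def using projection_diff[OF f(2) pm(3) fp(1)] .
  then have n: "n * n = n" "star n = n"
    by (simp_all add: projection_def)
  have nf: "n * f = n" "n = f * (1 - p)" "n * e = 0"
    by (simp_all add: n_def algebra_simps ff fp e ep0)
  have fm: "f * m = m * f"
    using em by (simp add: e_def algebra_simps)
  have nm: "n * m = m * n"
    by (simp add: n_def algebra_simps fm pm(5))
  define X where "X = n * m"
  have "n * (b' - e) = - X"
    unfolding X_def nf(2) by (simp add: mult.assoc pm(7))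
  then have nb: "n * b' = - X"
    by (simp add: right_diff_distrib nf(3))
  have X: "nonneg X" "X * n = X" "star X = X"
    using nonneg_mult[OF nonneg_projection[OF pn] pm(4) nm] n
    by (auto simp: X_def nonneg_self_adjoint) (metis nm n(1) mult.assoc)
  have nG: "n * G = n * E + \<delta> *\<^sub>R n - X"
    by (simp add: GE distrib_left nf(1) nb)
  \<comment> \<open>On \<open>n\<close> the element \<open>G\<close> is \<delta> - \<open>X\<close>
    up to \<open>E\<close>. As \<open>G\<close> is nonnegative, in the form of the bound by
    \<open>t\<close>, this limits \<open>X\<close> to \<delta> + \<eta>; \<open>Y\<close> turns that
    into a norm estimate.\<close>
  define Y where "Y = (t - \<delta>) *\<^sub>R n + X"
  have "n * (t *\<^sub>R f - G) * n = t *\<^sub>R n - n * G * n"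
    by (simp add: right_diff_distrib left_diff_distrib nf(1) n)
  also have "n * G * n = n * E * n + \<delta> *\<^sub>R n - X"
    by (simp add: nG distrib_right left_diff_distrib n X)
  finally have "Y = n * (t *\<^sub>R f - G) * n + n * E * n"
    by (simp add: Y_def algebra_simps)
  moreover have "norm (n * (t *\<^sub>R f - G) * n) \<le> t" "norm (n * E * n) \<le> \<eta>"
    using norm_projection_mult_le[OF pn] t E order_trans by meson+
  ultimately have "norm Y \<le> t + \<eta>"
    using norm_triangle_le by (metis add_mono)
  moreover have "star Y = Y"
    by (simp add: Y_def star_simps n X)
  ultimately have "nonneg ((t + \<eta>) *\<^sub>R 1 - Y)"
    by (intro nonneg_diff)
  moreover have Yn: "n * Y = Y" "Y * n = Y"
    using X n by (simp_all add: Y_def algebra_simps) (metis X_def n(1) mult.assoc)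
  ultimately have "nonneg (((t + \<eta>) *\<^sub>R 1 - Y) * n)"
    using nonneg_projection[OF pn] by (intro nonneg_mult) (auto simp: algebra_simps)
  moreover have "nonneg ((\<delta> + \<eta>) *\<^sub>R (1 - n))"
    using \<delta> \<eta> by (intro nonneg_scaleR nonneg_projection projection_compl pn) auto
  ultimately have "nonneg (((t + \<eta>) *\<^sub>R 1 - Y) * n + (\<delta> + \<eta>) *\<^sub>R (1 - n))"
    by (rule nonneg_add)
  moreover have "((t + \<eta>) *\<^sub>R 1 - Y) * n + (\<delta> + \<eta>) *\<^sub>R (1 - n) = (\<delta> + \<eta>) *\<^sub>R 1 - X"
    by (simp add: left_diff_distrib Yn) (simp add: Y_def algebra_simps)
  ultimately have "norm X \<le> \<delta> + \<eta>"
    using X(1) \<delta> \<eta> by (intro norm_le_of_nonneg_diff) auto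
  moreover have "norm (n * E) \<le> \<eta>"
    using norm_projection_mult_le(1)[OF pn] E order_trans by blast
  moreover have "norm (\<delta> *\<^sub>R n) \<le> \<delta>"
    using norm_projection_le[OF pn] \<delta> by simp
  moreover have "norm (n * G) \<le> norm (n * E) + norm (\<delta> *\<^sub>R n) + norm X"
    unfolding nG using norm_triangle_ineq4[of "n * E + \<delta> *\<^sub>R n" X] norm_triangle_ineq[of "n * E" "\<delta> *\<^sub>R n"]
    by linarith
  ultimately have "norm ((f - p) * G) \<le> 2 * \<delta> + 2 * \<eta>"
    by (simp add: n_def)
  moreover have "j \<in> C" "p * j = j" "j * p = j"
    using i(1) pm(1) by (auto simp: j_def subalgebra[OF C(1)] mult.assoc pp)
      (metis pi pp(1) mult.assoc)
  ultimately show thesis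
    using that pm(1,3) fp(1) jG nj by blast
qed

lemma norm_mult_mono:
  fixes x y :: "'a::real_normed_algebra"
  assumes "norm x \<le> s" "norm y \<le> t"
  shows "norm (x * y) \<le> s * t"
  using assms by (intro order_trans[OF norm_mult_ineq mult_mono']) auto

section \<open>Large subalgebras\<close>

lemma mat_norm_entry:
  assumes "cstar_subalgebra C"
  shows "ennreal (norm (T 0 0)) \<le> mat_norm C T"
proof -
  have "(\<lambda>_. 1) \<in> module_ball C 1"
    using subalgebra_one[OF assms] by (simp add: module_ball_def)
  then show ?thesis
    unfolding mat_norm_def
    by (intro SUP_upper2[of "1::nat"] SUP_upper2[of "\<lambda>_. 1"]) simp_all
qed

lemma infsum_single_index:
  fixes f :: "nat \<Rightarrow> 'a::{comm_monoid_add, t2_space}"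
  assumes "\<And>k. k \<noteq> i \<Longrightarrow> f k = 0"
  shows "infsum f UNIV = f i"
proof -
  have "infsum f UNIV = infsum f {i}"
    using assms by (intro infsum_cong_neutral) auto
  then show ?thesis
    by simp
qed

text \<open>Only the entry \<open>v n 0 0\<close> enters the (0,0) entry of the product, and that
  entry is bounded by the matrix norm. So comparison in the stabilization gives comparison in
  \<open>C\<close>.\<close>

lemma cuntz_le_corner:
  fixes g y :: "'a::cstar_algebra_1"
  assumes C: "cstar_subalgebra C" and le: "cuntz_le C (corner g) (corner y)" and \<eta>: "0 < \<eta>"
  obtains w where "w \<in> C" "norm (w * y * star w - g) < \<eta>"
proof -
  obtain v where v: "\<And>n. v n \<in> stabilization C"
    and lim: "(\<lambda>n. mat_norm C (\<lambda>i j. mat_mult (mat_mult (v n) (corner y)) (mat_star (v n)) i j - corner g i j))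
       \<longlonglongrightarrow> 0"
    using le unfolding cuntz_le_def by blast
  have "eventually (\<lambda>n. mat_norm C (\<lambda>i j. mat_mult (mat_mult (v n) (corner y)) (mat_star (v n)) i j
      - corner g i j) < ennreal \<eta>) sequentially"
    using order_tendstoD(2)[OF lim, of "ennreal \<eta>"] \<eta> by simp
  then obtain n where n: "mat_norm C (\<lambda>i j. mat_mult (mat_mult (v n) (corner y)) (mat_star (v n)) i j
      - corner g i j) < ennreal \<eta>"
    using eventually_happens'[OF sequentially_bot] by blast
  have 1: "mat_mult (v n) (corner y) i j = (if j = 0 then v n i 0 * y else 0)" for i j
    unfolding mat_mult_def by (subst infsum_single_index[of 0]) (auto simp: corner_def)
  have 2: "mat_mult (mat_mult (v n) (corner y)) (mat_star (v n)) 0 0 = v n 0 0 * y * star (v n 0 0)"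
    unfolding mat_mult_def[of "mat_mult (v n) (corner y)"]
    by (subst infsum_single_index[of 0]) (auto simp: 1 mat_star_def)
  have "ennreal (norm (v n 0 0 * y * star (v n 0 0) - g)) < ennreal \<eta>"
    using order.strict_trans1[OF mat_norm_entry[OF C] n] unfolding 2 by (simp add: corner_def)
  then have "norm (v n 0 0 * y * star (v n 0 0) - g) < \<eta>"
    by (simp add: ennreal_less_iff)
  moreover have "v n 0 0 \<in> C"
    using v[of n] by (simp add: stabilization_def)
  ultimately show thesis
    using that by blast
qed

lemma positive_contraction:
  fixes g :: "'a::cstar_algebra_1"
  assumes "g \<in> positive_of C" "1 - g \<in> positive_of C"
  shows "g \<in> C" "star g = g" "nonneg g" "norm (1 - g) \<le> 1"
proof -
  show "nonneg g"
    using assms(1) by (rule nonneg_of_positive)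
  moreover have "nonneg (1 - g)"
    using assms(2) by (rule nonneg_of_positive)
  ultimately show "norm (1 - g) \<le> 1"
    by (intro norm_le_of_nonneg_diff) auto
  show "g \<in> C" "star g = g"
    using assms(1) by (simp_all add: positive_of_def self_adjoint_of_def)
qed

section \<open>Projections almost annihilating a non-invertible element\<close>

text \<open>The witness is a multiple of the resolvent \<open>i = (a\<^sup>2 + \<kappa>)\<^sup>-\<^sup>1\<close>; since \<open>1 - \<kappa> i = a\<^sup>2 i\<close> is not
  invertible, \<open>\<parallel>i\<parallel> \<ge> 1 / \<kappa>\<close>.\<close>

lemma approximate_kernel:
  fixes a :: "'a::cstar_algebra_1"
  assumes a: "star a = a" "\<not> invertible_in UNIV a" and \<delta>: "0 < \<delta>"
  obtains x where "nonneg x" "norm x = 1" "norm (x * a) \<le> \<delta>"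
proof -
  \<comment> \<open>Chosen so that the estimate of \<open>norm (i * a)\<close> below, with square at
    most twice \<kappa> times the square of \<open>norm i\<close>, gives exactly \<delta>.\<close>
  define \<kappa> where "\<kappa> = \<delta>\<^sup>2 / 2"
  have \<kappa>: "0 < \<kappa>"
    using \<delta> by (simp add: \<kappa>_def)
  obtain i where i: "(a * a + \<kappa> *\<^sub>R 1) * i = 1" "i * (a * a + \<kappa> *\<^sub>R 1) = 1"
    using inverse_nonneg_add[OF cstar_subalgebra_UNIV UNIV_I nonneg_square[OF a(1)] \<kappa>] by metis
  have "star (a * a + \<kappa> *\<^sub>R 1) = a * a + \<kappa> *\<^sub>R 1"
    by (simp add: star_simps a)
  then have si: "star i = i"
    using inverse_self_adjoint i by metis
  have ai: "a * i = i * a"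
    using commute_inverse[OF i, of a] by (simp add: algebra_simps)
  have aai: "a * a * i = 1 - \<kappa> *\<^sub>R i" "i * (a * a) = 1 - \<kappa> *\<^sub>R i"
    using i by (simp_all add: algebra_simps)
  have big: "1 \<le> \<kappa> * norm i"
  proof (rule ccontr)
    assume "\<not> ?thesis"
    then have "norm (\<kappa> *\<^sub>R i) < 1"
      using \<kappa> by simp
    then obtain z where z: "(1 - \<kappa> *\<^sub>R i) * z = 1" "z * (1 - \<kappa> *\<^sub>R i) = 1"
      using neumann_inverse[OF cstar_subalgebra_UNIV UNIV_I] by metis
    have "a * (a * i * z) = 1"
      using z(1) by (simp add: aai(1)[symmetric] mult.assoc)
    moreover have "(z * i * a) * a = 1"
      using z(2) by (simp add: aai(2)[symmetric] mult.assoc)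
    ultimately show False
      using a(2) invertibleI by blast
  qed
  then have ni: "0 < norm i"
    using \<kappa> by (cases "norm i = 0") auto
  define x where "x = (1 / norm i) *\<^sub>R i"
  have "i = i * (a * a + \<kappa> *\<^sub>R 1) * i"
    by (simp add: i)
  also have "\<dots> = (a * i) * (a * i) + \<kappa> *\<^sub>R (i * i)"
    by (simp add: distrib_left distrib_right ai mult.assoc)
  finally have "nonneg i"
    by (metis \<kappa> a(1) ai less_imp_le nonneg_add nonneg_scaleR nonneg_square si star_mult)
  then have 1: "nonneg x"
    by (simp add: x_def nonneg_scaleR)
  have "i * a * star (i * a) = i * (1 - \<kappa> *\<^sub>R i)"
    unfolding aai(1)[symmetric] by (simp add: star_simps a si mult.assoc)
  then have "(norm (i * a))\<^sup>2 = norm (i * (1 - \<kappa> *\<^sub>R i))"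
    by (metis norm_mult_star)
  also have "\<dots> \<le> norm i * (1 + \<kappa> * norm i)"
    using norm_triangle_ineq4[of 1 "\<kappa> *\<^sub>R i"] \<kappa>
    by (intro order_trans[OF norm_mult_ineq] mult_left_mono) auto
  also have "\<dots> \<le> norm i * (\<kappa> * norm i + \<kappa> * norm i)"
    using big by (intro mult_left_mono) auto
  also have "\<dots> = (\<delta> * norm i)\<^sup>2"
    by (simp add: \<kappa>_def power2_eq_square)
  finally have "norm (i * a) \<le> \<delta> * norm i"
    by (rule power2_le_imp_le) (use \<delta> ni in simp)
  then have "norm (x * a) \<le> \<delta>"
    using ni by (simp add: x_def pos_divide_le_eq)
  then show thesis
    using that 1 ni by (simp add: x_def)
qed

text \<open>The only place where central largeness is used, rather than largeness.\<close>

lemma approximate_kernel_projection: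
  fixes a :: "'a::cstar_algebra_1"
  assumes B: "centrally_large B" "real_rank_zero B"
    and a: "star a = a" "\<not> invertible_in UNIV a" and \<delta>: "0 < \<delta>"
  obtains r where "r \<in> B" "projection r" "r \<noteq> 0" "norm (r * a) \<le> \<delta>"
proof -
  have C: "cstar_subalgebra B"
    using B(1) by (simp add: centrally_large_def)
  define A where "A = norm a + 2"
  have A: "0 < A" "norm a \<le> A"
    by (simp_all add: A_def add_nonneg_pos)
  define \<epsilon> where "\<epsilon> = min (1/16) (\<delta> / (32 * A))"
  have \<epsilon>: "0 < \<epsilon>" "\<epsilon> \<le> 1/16" "\<epsilon> * A \<le> \<delta> / 32"
    using \<delta> A(1) by (auto simp: \<epsilon>_def min_def field_simps)
  obtain x where x: "nonneg x" "norm x = 1" "norm (x * a) \<le> \<epsilon>"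
    using approximate_kernel[OF a \<epsilon>(1)] .
  have sx: "star x = x"
    using x(1) by (rule nonneg_self_adjoint)
  have "projection (1::'a)"
    by (simp add: projection_def)
  then have one: "(1::'a) \<in> positive_of B - {0}"
    using positive_of_projection[OF C subalgebra_one[OF C]] by simp
  \<comment> \<open>The entry \<open>a\<close> provides the commutator estimate, the entry
    \<open>x\<close> an approximation of \<open>h * x\<close> in \<open>B\<close>.\<close>
  obtain c g where w: "large_witness B 2 (\<lambda>j. if j = 1 then a else x) \<epsilon> x 1 c g"
    and comm: "\<forall>j\<in>{1..2::nat}. norm (g * (if j = 1 then a else x) - (if j = 1 then a else x) * g) < \<epsilon>"
    using B(1)[unfolded centrally_large_def] positive_of_nonneg[OF x(1)] one x(2) \<epsilon>(1)
    by (metis one_le_numeral)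
  define h where "h = 1 - g"
  have "g \<in> positive_of B" "1 - g \<in> positive_of B"
    using w by (simp_all add: large_witness_def)
  from positive_contraction[OF this]
  have h: "h \<in> B" "star h = h" "norm h \<le> 1"
    by (simp_all add: h_def subalgebra[OF C] star_simps)
  have hc: "h * c 2 \<in> B" "norm (c 2 - x) < \<epsilon>" "1 - \<epsilon> < norm (h * x * h)"
    using w by (auto simp: large_witness_def h_def split: if_splits dest: bspec[of _ _ 2])
  have "norm (g * a - a * g) < \<epsilon>"
    using comm by (auto dest: bspec[of _ _ 1])
  then have ha: "norm (h * a - a * h) < \<epsilon>"
    by (simp add: h_def algebra_simps norm_minus_commute)
  note le = norm_mult_le_of_norm_le_one[OF h(3)]
  define y where "y = h * x * h"
  define b0 where "b0 = h * c 2 * h"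
  define b where "b = (1/2) *\<^sub>R (b0 + star b0)"
  have "b0 \<in> B"
    using hc(1) h(1) by (simp add: b0_def subalgebra[OF C])
  then have b: "b \<in> B" "star b = b"
    by (simp_all add: b_def subalgebra[OF C] star_simps add.commute)
  have sy: "star y = y"
    by (simp add: y_def star_simps h sx mult.assoc)
  have "b0 - y = h * (c 2 - x) * h"
    by (simp add: b0_def y_def algebra_simps)
  then have "norm (b0 - y) \<le> \<epsilon>"
    using le hc(2) by (metis less_imp_le order_trans)
  moreover have "b - y = (1/2) *\<^sub>R ((b0 - y) + star (b0 - y))"
  proof -
    have "(b0 - y) + star (b0 - y) = (b0 + star b0) - (y + y)"
      by (simp add: star_diff sy)
    then show ?thesis
      by (simp only: b_def scaleR_right_diff_distrib scaleR_half_double)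
  qed
  ultimately have b_y: "norm (b - y) \<le> \<epsilon>"
    using norm_triangle_ineq[of "b0 - y" "star (b0 - y)"] by simp
  have ny: "norm y \<le> 1"
    using le[of x] le[of "h * x"] x(2) by (simp add: y_def)
  have nb: "norm b \<le> 2" "7/8 \<le> norm b"
    using norm_triangle_ineq2[of b y] norm_triangle_ineq2[of y b] norm_minus_commute[of b y] b_y ny hc(3) \<epsilon>(2)
    by (simp_all add: y_def)
  \<comment> \<open>Moving \<open>h\<close> past \<open>a\<close> brings \<open>x * a\<close>
    together; this costs one commutator.\<close>
  have "y * a = h * x * (h * a - a * h) + h * (x * a) * h"
    by (simp add: y_def algebra_simps)
  moreover have "norm (h * x * (h * a - a * h)) \<le> 1 * \<epsilon>"
    using le(1)[of x] unfolding x(2) by (intro norm_mult_mono less_imp_le[OF ha])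
  moreover have "norm (h * (x * a) * h) \<le> \<epsilon>"
    using le x(3) order_trans by meson
  ultimately have "norm (y * a) \<le> 2 * \<epsilon>"
    using norm_triangle_ineq[of "h * x * (h * a - a * h)" "h * (x * a) * h"] by simp
  moreover have "norm ((b - y) * a) \<le> \<epsilon> * norm a"
    using b_y by (intro norm_mult_mono) auto
  moreover have "b * a = (b - y) * a + y * a"
    by (simp add: algebra_simps)
  ultimately have ba: "norm (b * a) \<le> \<epsilon> * A"
    using norm_triangle_ineq[of "(b - y) * a" "y * a"] by (simp add: A_def distrib_left)
  \<comment> \<open>Squaring makes \<open>b\<close> nonnegative and keeps the product with
    \<open>a\<close> small. As \<open>norm G \<ge> (7/8)\<^sup>2\<close>, the threshold 1/8 cannot
    give \<open>p = 0\<close>.\<close>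
  define G where "G = b * b"
  have G: "G \<in> B" "star G = G" "nonneg G"
    using subalgebra_mult[OF C b(1) b(1)] nonneg_square[OF b(2)] by (simp_all add: G_def star_mult b(2))
  have Ga: "norm (G * a) \<le> 2 * (\<epsilon> * A)"
    unfolding G_def mult.assoc using nb(1) ba by (rule norm_mult_mono)
  have eighth: "0 < (1/8 :: real)"
    by simp
  obtain p j where pj: "p \<in> B" "projection p" "norm (j * G - p) \<le> \<epsilon> / (1/8)" "norm j \<le> 1 / (1/8)"
      "norm ((1 - p) * G) \<le> 2 * (1/8) + 2 * \<epsilon>"
    by (rule real_rank_zero_projection[OF C B(2) subalgebra_one[OF C] \<open>projection 1\<close> G(1,2)
        mult_1_left nonneg_norm_diff_le[OF G(3) order_refl] eighth \<epsilon>(1)]) blast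
  have "p \<noteq> 0"
  proof
    assume "p = 0"
    then have "norm G \<le> 1/2"
      using pj(5) \<epsilon>(2) by simp
    moreover have "norm G = (norm b)\<^sup>2"
      using b(2) by (simp add: G_def norm_square_self_adjoint)
    moreover have "(7/8)\<^sup>2 \<le> (norm b)\<^sup>2"
      using nb(2) by (intro power_mono) auto
    ultimately show False
      by (simp add: power2_eq_square)
  qed
  moreover have "norm (p * a) \<le> \<delta>"
  proof -
    have "p * a = j * (G * a) - (j * G - p) * a"
      by (simp add: algebra_simps)
    then have "norm (p * a) \<le> norm (j * (G * a)) + norm ((j * G - p) * a)"
      by (metis norm_triangle_ineq4)
    also have "\<dots> \<le> 8 * (2 * (\<epsilon> * A)) + (8 * \<epsilon>) * A"
      using pj(3,4) by (intro add_mono norm_mult_mono[OF _ Ga] norm_mult_mono[OF _ A(2)]) auto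
    also have "\<dots> \<le> \<delta>"
      using \<epsilon>(3) \<delta> by (simp add: algebra_simps)
    finally show ?thesis .
  qed
  ultimately show thesis
    using that pj(1,2) by blast
qed

section \<open>Invertible perturbation when a projection annihilates the element\<close>

text \<open>For the block matrix \<open>T\<close> with rows \<open>(\<alpha>, u, \<beta>)\<close>, \<open>(u\<^sup>*, 0, 0)\<close>, \<open>(\<beta>\<^sup>*, 0, D)\<close>; here \<open>U\<close>, \<open>U'\<close> and \<open>D'\<close>
  are the inverses of \<open>u\<close>, \<open>u\<^sup>*\<close> and \<open>D\<close>, and \<open>\<beta>'\<close> is \<open>\<beta>\<^sup>*\<close>.\<close>

lemma block_right_inverse:
  fixes T :: "'a::ring_1"
  assumes "T * U' = \<alpha> * U' + \<beta>' * U' + q" "T * U = p" "T * D' = \<beta> * D' + s"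
    and "p * \<alpha> = \<alpha>" "p * \<beta> = \<beta>" "s * \<beta>' = \<beta>'" "p + q + s = 1"
  obtains S where "T * S = 1"
proof -
  \<comment> \<open>Back substitution: \<open>V\<close> cancels \<open>\<beta>' * U'\<close> at the
    price of \<open>\<beta> * V\<close>. All other unwanted terms lie in the range of
    \<open>p\<close>, where \<open>T * U = p\<close> removes them.\<close>
  define V where "V = - (D' * \<beta>' * U')"
  have V: "T * V = \<beta> * V - \<beta>' * U'"
    using assms(3,6) by (simp add: V_def flip: mult.assoc) (simp add: distrib_right)
  have W: "T * (U * \<beta> * D') = \<beta> * D'"
    using assms(2,5) by (simp flip: mult.assoc)
  have Z: "T * (U * (\<alpha> * U' + \<beta> * V)) = \<alpha> * U' + \<beta> * V"
    using assms(2,4,5) by (simp add: distrib_left flip: mult.assoc)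
  have "T * (U' + U + D' + V - U * \<beta> * D' - U * (\<alpha> * U' + \<beta> * V)) = p + q + s"
    unfolding right_diff_distrib distrib_left[of T] V W Z assms(1-3) by simp
  then show thesis
    using that assms(7) by simp
qed

text \<open>Exact annihilation by \<open>r\<close> gives \<open>a * q = 0\<close> for every
  \<open>q\<close> below \<open>r\<close>. This produces the zero blocks that make invertibility
  independent of \<alpha> and \<beta>.\<close>

lemma invertible_perturbation:
  fixes a :: "'a::cstar_algebra_1"
  assumes B: "centrally_large B" "real_rank_zero B"
    and a: "star a = a" and r: "r \<in> B" "projection r" "r \<noteq> 0" "r * a = 0" and \<epsilon>: "0 < \<epsilon>"
  obtains T where "star T = T" "invertible_in UNIV T" "norm (T - a) < \<epsilon>"
proof -
  have C: "cstar_subalgebra B"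
    using B(1) by (simp add: centrally_large_def)
  define f where "f = 1 - r"
  have rr: "r * r = r" "star r = r"
    using r(2) by (simp_all add: projection_def)
  have pf: "projection f"
    unfolding f_def by (rule projection_compl[OF r(2)])
  then have ff: "f * f = f" "star f = f"
    by (simp_all add: projection_def)
  have fB: "f \<in> B"
    using r(1) by (simp add: f_def subalgebra[OF C])
  have ar: "a * r = 0"
    using arg_cong[OF r(4), of star] by (simp add: star_simps a rr)
  have fa: "f * a = a" "a * f = a"
    by (simp_all add: f_def algebra_simps r(4) ar)
  have rf: "r * f = 0" "f * r = 0"
    by (simp_all add: f_def algebra_simps rr)
  define A where "A = norm a + 1"
  have A: "0 < A" "norm a \<le> A"
    by (simp_all add: A_def add_nonneg_pos)
  \<comment> \<open>\<delta> keeps \<open>(f - p) * G * a\<close> below \<open>\<epsilon>/4\<close>;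
    the ratio 1/4 of \<eta> to \<delta> keeps \<open>j * W0\<close> within 1/2 of
    \<open>p\<close>.\<close>
  define \<delta> where "\<delta> = \<epsilon> / (16 * A)"
  define \<eta> where "\<eta> = \<delta> / 4"
  have \<delta>: "0 < \<delta>" "\<delta> * A = \<epsilon> / 16" and \<eta>: "0 < \<eta>" "\<eta> / \<delta> = 1/4"
    using \<epsilon> A(1) by (simp_all add: \<delta>_def \<eta>_def)
  have "nonneg (1::'a)"
    using nonneg_scaleR_one[of 1] by simp
  then have one: "(1::'a) \<in> positive_of UNIV"
    by (rule positive_of_nonneg)
  have ry: "r \<in> positive_of B - {0}"
    using positive_of_projection[OF C r(1,2)] r(3) by simp
  obtain c g where w: "large_witness B 1 (\<lambda>_. a) (\<epsilon>/8) 1 r c g"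
    using B(1)[unfolded centrally_large_def] one ry \<epsilon>
    by (metis le_refl norm_one zero_less_divide_iff zero_less_numeral)
  have g0: "g \<in> positive_of B" "1 - g \<in> positive_of B"
    using w by (simp_all add: large_witness_def)
  note g = positive_contraction[OF g0]
  have c: "(1 - g) * c 1 \<in> B" "norm (c 1 - a) < \<epsilon>/8"
    using w by (auto simp: large_witness_def)
  obtain v where v: "v \<in> B" "norm (v * r * star v - g) < \<eta>"
    using cuntz_le_corner[OF C _ \<eta>(1), of g r] w by (auto simp: large_witness_def)
  define G where "G = f * g * f"
  have G: "G \<in> B" "star G = G" "f * G = G"
    using fB g by (simp_all add: G_def subalgebra[OF C] star_simps ff mult.assoc)
      (simp add: ff flip: mult.assoc)
  have "1 *\<^sub>R f - G = f * (1 - g) * f"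
    by (simp add: G_def algebra_simps ff)
  then have "norm (1 *\<^sub>R f - G) \<le> 1"
    using norm_projection_mult_le[OF pf] g(4) by (metis order_trans)
  then obtain p j where p: "p \<in> B" "projection p" "f * p = p" and j: "j \<in> B" "p * j = j" "j * p = j"
    "norm (j * G - p) \<le> \<eta> / \<delta>" "norm j \<le> 1 / \<delta>" and n_small: "norm ((f - p) * G) \<le> 2 * \<delta> + 2 * \<eta>"
    using real_rank_zero_projection[OF C B(2) fB pf G _ \<delta>(1) \<eta>(1), of 1] by blast
  have pp: "p * p = p" "star p = p"
    using p(2) by (simp_all add: projection_def)
  have pf': "p * f = p"
    using star_mult[of f p] p(3) pp ff by simp
  have pr: "p * r = 0" "r * p = 0"
    by (metis pf' rf mult.assoc mult_zero_right) (metis p(3) rf mult.assoc mult_zero_left)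
  \<comment> \<open>Since \<open>z * star z\<close> is near \<open>G\<close>, the element
    \<open>u0\<close> leads from \<open>r\<close> to \<open>p\<close>, and \<open>W0\<close> is near
    the \<open>p\<close>-corner of \<open>G\<close>, which \<open>j\<close> nearly inverts.\<close>
  define z where "z = f * v * r"
  define u0 where "u0 = p * z"
  define W0 where "W0 = u0 * star u0"
  have zG: "norm (z * star z - G) \<le> \<eta>"
  proof -
    have "z * star z - G = f * (v * (r * r) * star v - g) * f"
      by (simp add: z_def G_def star_simps ff(2) rr(2) left_diff_distrib right_diff_distrib mult.assoc)
    then show ?thesis
      unfolding rr(1) using norm_projection_mult_le[OF pf] v(2) by (metis less_imp_le order_trans)
  qed
  have jW: "j * W0 - p = (j * G - p) * p + j * (z * star z - G) * p"
  proof -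
    have "j * W0 = (j * p) * z * star z * p"
      by (simp add: W0_def u0_def star_simps pp mult.assoc)
    then show ?thesis
      by (simp add: j(3) algebra_simps pp)
  qed
  have "norm (j * (z * star z - G)) \<le> 1 / \<delta> * \<eta>"
    using j(5) zG by (intro norm_mult_mono)
  also have "\<dots> = 1/4"
    using \<eta>(2) by simp
  finally have "norm (j * (z * star z - G) * p) \<le> 1/4"
    using order_trans[OF norm_projection_mult_le(2)[OF p(2)]] by blast
  moreover have "norm ((j * G - p) * p) \<le> 1/4"
    using order_trans[OF norm_projection_mult_le(2)[OF p(2)] j(4)] \<eta>(2) by simp
  ultimately have "norm (j * W0 - p) < 1"
    unfolding jW using norm_triangle_ineq[of "(j * G - p) * p" "j * (z * star z - G) * p"] by linarith
  then have "norm (p - j * W0) < 1"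
    by (simp add: norm_minus_commute)
  moreover have W0B: "W0 \<in> B" "u0 \<in> B"
    using fB v(1) r(1) p(1) by (simp_all add: W0_def u0_def z_def subalgebra[OF C])
  ultimately obtain i where i: "i \<in> B" "i * (1 - (p - j * W0)) = 1"
    using neumann_inverse[OF C, of "p - j * W0"] p(1) j(1) by (auto simp: subalgebra[OF C])
  have W0p: "W0 * p = W0" "star W0 = W0"
    by (simp_all add: W0_def u0_def star_simps pp mult.assoc)
  \<comment> \<open>The invertible \<open>1 - (p - j * W0)\<close> acts as \<open>j * W0\<close>
    under \<open>p\<close>, so \<open>i * j\<close> is a left inverse of \<open>W0\<close> in the
    corner.\<close>
  have ijW: "i * j * W0 = p"
  proof -
    have "(1 - (p - j * W0)) * p = j * W0"
      by (simp add: left_diff_distrib pp W0p mult.assoc)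
    then have "i * (j * W0) = (i * (1 - (p - j * W0))) * p"
      by (simp add: mult.assoc)
    then show ?thesis
      by (simp add: i mult.assoc)
  qed
  \<comment> \<open>Scaling makes \<open>u\<close> small in norm without affecting its invertibility
    from \<open>q\<close> to \<open>p\<close>.\<close>
  define \<tau> where "\<tau> = \<epsilon> / (16 * (norm u0 + 1))"
  have N: "0 < norm u0 + 1"
    by (simp add: add_nonneg_pos)
  then have \<tau>: "0 < \<tau>" "\<tau> * (norm u0 + 1) = \<epsilon> / 16"
    using \<epsilon> by (simp_all add: \<tau>_def field_simps)
  define u where "u = \<tau> *\<^sub>R u0"
  define W where "W = u * star u"
  define k where "k = (1 / \<tau>\<^sup>2) *\<^sub>R (p * i * j)"
  have "W = \<tau>\<^sup>2 *\<^sub>R W0"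
    by (simp add: W_def W0_def u_def star_simps power2_eq_square)
  then have kW: "k * W = p"
    using \<tau>(1) ijW by (simp add: k_def mult.assoc pp)
  have kp: "k * p = k" "p * k = k"
    by (simp_all add: k_def mult.assoc j pp) (simp add: pp flip: mult.assoc)
  have u: "u * r = u" "p * u = u" "r * star u = star u" "star u * p = star u"
    by (simp_all add: u_def u0_def z_def star_simps mult.assoc rr pp)
      (simp_all add: rr pp flip: mult.assoc)
  have sW: "star W = W"
    by (simp add: W_def star_simps)
  have sk: "star k = k"
  proof -
    have "W * star k = p"
      using arg_cong[OF kW, of star] by (simp add: star_simps sW pp)
    then have "k = k * W * star k"
      by (simp add: kp mult.assoc)
    also have "\<dots> = star (k * p)"
      by (simp add: kW star_simps pp)
    finally show ?thesis
      by (simp add: kp)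
  qed
  have Wk: "W * k = p"
    using arg_cong[OF kW, of star] by (simp add: star_simps sW pp sk)
  have kB: "k \<in> B" and uB: "u \<in> B"
    using i(1) j(1) p(1) W0B by (simp_all add: k_def u_def subalgebra[OF C])
  \<comment> \<open>The support projection of \<open>u\<close>, written algebraically with
    \<open>k\<close>, the inverse of \<open>W = u * star u\<close> in the
    \<open>p\<close>-corner.\<close>
  define q where "q = star u * k * u"
  have qu: "q * star u = star u"
  proof -
    have "q * star u = star u * (k * W)"
      by (simp add: q_def W_def mult.assoc)
    then show ?thesis
      by (simp add: kW u)
  qed
  have sq: "star q = q"
    by (simp add: q_def star_simps sk mult.assoc)
  have uq: "u * q = u"
    using arg_cong[OF qu, of star] by (simp add: star_simps sq)
  have qq: "q * q = q"
    by (metis q_def qu mult.assoc)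
  have rq: "r * q = q" "q * r = q"
    by (simp_all add: q_def mult.assoc u) (simp add: u flip: mult.assoc)
  have pq: "p * q = 0" "q * p = 0"
    by (metis rq(1) pr mult.assoc mult_zero_left) (metis rq(2) pr mult.assoc mult_zero_right)
  define n where "n = f - p"
  have pn: "projection n"
    unfolding n_def by (rule projection_diff[OF pf p(2,3)])
  then have nn: "n * n = n" "star n = n"
    by (simp_all add: projection_def)
  have nr: "n * r = 0" "r * n = 0"
    by (simp_all add: n_def algebra_simps rf pr)
  have np: "n * p = 0" "p * n = 0" "n * f = n"
    by (simp_all add: n_def algebra_simps p(3) pp pf' ff)
  have qn: "q * n = 0" "n * q = 0"
    by (metis rq(2) nr(2) mult.assoc mult_zero_right) (metis rq(1) nr(1) mult.assoc mult_zero_left)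
  define s where "s = 1 - p - q"
  have ps: "projection s"
    by (simp add: projection_def s_def algebra_simps pp qq pq star_simps sq)
  have "q \<in> B"
    using kB uB by (simp add: q_def subalgebra[OF C])
  then have sB: "s \<in> B"
    using p(1) by (simp add: s_def subalgebra[OF C])
  have sn: "s * n = n" "n * s = n" "s * p = 0" "p * s = 0"
    by (simp_all add: s_def algebra_simps np qn pp pq)
  have nB: "n \<in> B"
    using fB p(1) by (simp add: n_def subalgebra[OF C])
  define x0 where "x0 = n * ((1 - g) * c 1) * n"
  define D0 where "D0 = (1/2) *\<^sub>R (x0 + star x0)"
  have "x0 \<in> B"
    using nB c(1) by (simp add: x0_def subalgebra[OF C])
  then have D0: "D0 \<in> B" "star D0 = D0" "s * D0 = D0"
    by (simp_all add: D0_def subalgebra[OF C] star_simps add.commute)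
      (simp add: x0_def star_simps nn distrib_left sn flip: mult.assoc)
  have \<epsilon>8: "0 < \<epsilon>/8"
    using \<epsilon> by simp
  \<comment> \<open>The corner \<open>s\<close> is \<open>n + (r - q)\<close>, where
    \<open>D0\<close> vanishes on the second part; the perturbation \<open>D\<close> is invertible
    on all of \<open>s\<close>.\<close>
  obtain D D' where D: "D \<in> B" "star D = D" "D * s = D" "norm (D - D0) < \<epsilon>/8"
    and D': "s * D' = D'" "D * D' = s"
    by (rule corner_real_rank_zero[OF C B(2) sB ps D0 \<epsilon>8]) blast
  have nan: "norm (n * a * n - D0) \<le> \<epsilon> / 4 + \<epsilon> / 8"
  proof -
    \<comment> \<open>Splitting \<open>a\<close> by \<open>g\<close> and \<open>1 - g\<close>: the
      first part is small by the choice of \<open>p\<close>, the second lies near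
      \<open>B\<close>.\<close>
    have "n * a * n - x0 = (n * G * a + n * ((1 - g) * (a - c 1))) * n"
    proof -
      have "n * G * a = n * f * g * (f * a)"
        by (simp add: G_def mult.assoc)
      then show ?thesis
        by (simp add: np fa x0_def algebra_simps)
    qed
    moreover have "norm (n * G * a) \<le> (2 * \<delta> + 2 * \<eta>) * A"
      using n_small A by (intro norm_mult_mono) (auto simp: n_def)
    moreover have "(2 * \<delta> + 2 * \<eta>) * A \<le> \<epsilon> / 4"
      using \<delta>(2) \<epsilon> by (simp add: \<eta>_def algebra_simps)
    moreover have "norm (n * ((1 - g) * (a - c 1))) \<le> norm (a - c 1)"
      using norm_projection_mult_le(1)[OF pn] norm_mult_le_of_norm_le_one(1)[OF g(4)] order_trans by blast
    ultimately have x0: "norm (n * a * n - x0) \<le> \<epsilon> / 4 + \<epsilon> / 8"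
      using norm_projection_mult_le(2)[OF pn, of "n * G * a + n * ((1 - g) * (a - c 1))"]
        norm_triangle_ineq[of "n * G * a" "n * ((1 - g) * (a - c 1))"] c(2) norm_minus_commute[of a "c 1"]
      by simp
    have "star (n * a * n) = n * a * n"
      by (simp add: star_simps a nn mult.assoc)
    then have "(n * a * n - x0) + star (n * a * n - x0) = (n * a * n + n * a * n) - (x0 + star x0)"
      by (simp add: star_diff)
    then have "n * a * n - D0 = (1/2) *\<^sub>R ((n * a * n - x0) + star (n * a * n - x0))"
      by (simp only: D0_def scaleR_right_diff_distrib scaleR_half_double)
    then show ?thesis
      using x0 norm_triangle_ineq[of "n * a * n - x0" "star (n * a * n - x0)"] by simp
  qed
  \<comment> \<open>With respect to \<open>p\<close>, \<open>q\<close>, \<open>s\<close> this is the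
    block matrix with \<open>p * a * p\<close> as \<alpha> and \<open>p * a * n\<close> as
    \<beta>.\<close>
  define T where "T = a - n * a * n + D + u + star u"
  have sT: "star T = T"
    by (simp add: T_def star_simps a nn D mult.assoc)
  have nT: "norm (T - a) < \<epsilon>"
  proof -
    have "norm u \<le> \<epsilon> / 16"
      using \<tau> by (simp add: u_def distrib_left)
    moreover have "T - a = (D - D0) - (n * a * n - D0) + (u + star u)"
      by (simp add: T_def)
    ultimately show ?thesis
      using nan D(4) \<epsilon> norm_triangle_ineq[of u "star u"] norm_triangle_ineq4[of "D - D0" "n * a * n - D0"]
        norm_triangle_ineq[of "(D - D0) - (n * a * n - D0)" "u + star u"] by simp
  qed
  define U where "U = star u * k"
  have rU: "r * U = U" "p * U = 0" "n * U = 0" "s * U = 0"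
  proof -
    show 1: "r * U = U"
      by (simp add: U_def u flip: mult.assoc)
    show 2: "p * U = 0" "n * U = 0"
      by (metis 1 pr(1) mult.assoc mult_zero_left) (metis 1 nr(1) mult.assoc mult_zero_left)
    have "q * U = U"
      by (simp add: U_def qu flip: mult.assoc)
    then show "s * U = 0"
      by (simp add: s_def left_diff_distrib 2)
  qed
  have TU: "T * U = p"
  proof -
    have "a * U = 0" "D * U = 0" "star u * U = 0"
      by (metis rU(1) ar mult.assoc mult_zero_left, metis rU(4) D(3) mult.assoc mult_zero_right,
          metis rU(2) u(4) mult.assoc mult_zero_right)
    moreover have "u * U = p"
      using Wk by (simp add: U_def W_def mult.assoc)
    ultimately show ?thesis
      by (simp add: T_def distrib_right left_diff_distrib mult.assoc rU)
  qed
  define U' where "U' = k * u"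
  have pU': "p * U' = U'"
    by (simp add: U'_def kp flip: mult.assoc)
  have n0: "n * U' = 0" "D * U' = 0" "u * U' = 0"
    by (metis pU' np(1) mult.assoc mult_zero_left, metis pU' D(3) sn(3) mult.assoc mult_zero_right mult_zero_left,
        metis pU' u(1) pr(2) mult.assoc mult_zero_right mult_zero_left)
  have TU': "T * U' = (p * a * p) * U' + (n * a * p) * U' + q"
  proof -
    have "(p * a * p) * U' + (n * a * p) * U' = ((p + n) * a) * (p * U')"
      by (simp add: distrib_right mult.assoc)
    then have "(p * a * p) * U' + (n * a * p) * U' = a * U'"
      by (simp add: pU' n_def fa)
    moreover have "star u * U' = q"
      by (simp add: U'_def q_def mult.assoc)
    ultimately show ?thesis
      by (simp add: T_def distrib_right left_diff_distrib mult.assoc n0)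
  qed
  have TD': "T * D' = (p * a * n) * D' + s"
  proof -
    have "a * s = a * n"
    proof -
      have "a * q = 0"
        by (metis rq(1) ar mult.assoc mult_zero_left)
      then show ?thesis
        by (simp add: s_def n_def right_diff_distrib fa)
    qed
    then have "a * D' = a * n * D'"
      by (metis D'(1) mult.assoc)
    also have "a * n = p * a * n + n * a * n"
      using fa(1) by (simp add: n_def left_diff_distrib)
    finally have "a * D' - n * a * n * D' = p * a * n * D'"
      by (simp add: distrib_right)
    moreover have "u * s = 0"
      by (simp add: s_def right_diff_distrib uq) (metis u(1) pr(2) mult.assoc mult_zero_right)
    then have "u * D' = 0"
      by (metis D'(1) mult.assoc mult_zero_left)
    moreover have "star u * D' = 0"
      by (metis D'(1) u(4) sn(4) mult.assoc mult_zero_right mult_zero_left)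
    ultimately show ?thesis
      by (simp add: T_def distrib_right left_diff_distrib D'(2))
  qed
  obtain S where S: "T * S = 1"
  proof (rule block_right_inverse[OF TU' TU TD'])
    show "p * (p * a * p) = p * a * p" "p * (p * a * n) = p * a * n" "s * (n * a * p) = n * a * p"
      by (simp_all add: pp sn flip: mult.assoc)
    show "p + q + s = 1"
      by (simp add: s_def)
  qed
  have "star S * T = 1"
    using arg_cong[OF S, of star] by (simp add: star_simps sT)
  then show thesis
    using that sT S nT invertibleI by blast
qed

section \<open>Density of the invertible self-adjoint elements\<close>

theorem theorem3p11:
  fixes B :: "'a::cstar_algebra_1 set"
  assumes "infinite_dimensional (UNIV :: 'a set)"
    and "simple_cstar (UNIV :: 'a set)"
    and "centrally_large B"
    and "real_rank_zero B"
  shows "real_rank_zero (UNIV :: 'a set)"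
proof -
  have "\<exists>T. star T = T \<and> invertible_in UNIV T \<and> norm (T - a) < \<epsilon>"
    if a: "star a = a" and \<epsilon>: "0 < \<epsilon>" for a :: 'a and \<epsilon>
  proof (cases "invertible_in UNIV a")
    case True
    then show ?thesis
      using a \<epsilon> by (intro exI[of _ a]) simp
  next
    case False
    obtain r where r: "r \<in> B" "projection r" "r \<noteq> 0" "norm (r * a) \<le> \<epsilon>/4"
      using approximate_kernel_projection[OF assms(3,4) a False, of "\<epsilon>/4"] \<epsilon> by auto
    define a1 where "a1 = (1 - r) * a * (1 - r)"
    have rr: "r * r = r" "star r = r"
      using r(2) by (simp_all add: projection_def)
    have "star a1 = a1" "r * a1 = 0"
      by (simp_all add: a1_def star_simps a rr mult.assoc) (simp add: right_diff_distrib rr flip: mult.assoc)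
    then obtain T where T: "star T = T" "invertible_in UNIV T" "norm (T - a1) < \<epsilon>/4"
      using invertible_perturbation[OF assms(3,4) _ r(1-3), of a1 "\<epsilon>/4"] \<epsilon> by auto
    \<comment> \<open>Cutting down costs \<open>r * a\<close> and a compression of its adjoint, at
      most \<open>\<epsilon>/4\<close> each.\<close>
    have "a1 - a = - (r * a) - (1 - r) * star (r * a)"
      by (simp add: a1_def star_simps a rr algebra_simps)
    moreover have "norm ((1 - r) * star (r * a)) \<le> \<epsilon>/4"
      using norm_projection_mult_le(1)[OF projection_compl[OF r(2)], of "star (r * a)"] r(4) by simp
    ultimately have "norm (a1 - a) \<le> \<epsilon>/4 + \<epsilon>/4"
      using r(4) norm_triangle_ineq4[of "- (r * a)" "(1 - r) * star (r * a)"] by simp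
    then have "norm (T - a) < \<epsilon>"
      using T(3) norm_triangle_ineq[of "T - a1" "a1 - a"] \<epsilon> by simp
    then show ?thesis
      using T(1,2) by blast
  qed
  then show ?thesis
    by (fastforce simp: real_rank_zero_def closure_approachable self_adjoint_of_def dist_norm)
qed

end
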